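(* (i) There exists a strictly increasing sequence $\mathcal{A}=(a_n)_{n\ge1}$ of positive integers with $E(\mathcal{A}_N)=o(N^3)$ as $N\to\infty$ such that for Lebesgue almost all $x\in[0,1]$ the sequence $(a_nx)_{n\ge1}$ (taken modulo 1) does not have Poissonian correlations of any order $k\ge2$. (ii) Let $\mathcal{A}=(a_n)_{n\in\mathbb{N}}$ be a strictly increasing sequence of positive integers such that $\limsup_{N\to\infty}E(\mathcal{A}_N)/N^3>0$. Then there is a set of $x\in[0,1]$ of positive Lebesgue measure such that for each such $x$ the sequence $(a_nx)_{n\in\mathbb{N}}$ (modulo 1) does not have Poissonian triple (order $k=3$) correlations.
   Context: For a finite set $A$, its additive energy is $E(A)=\#\{(a,b,c,d)\in A^4: a+b=c+d\}$; $\mathcal{A}_N=\{a_1,\dots,a_N\}$. For a sequence $(y_n)\subseteq[0,1]$ (reals taken mod 1), $(\!(x)\!)$ denotes the signed distance of $x$ from the origin mod 1 ($=\{x\}$ if $\{x\}\le\frac12$, $=\{x\}-1$ otherwise). For compactly supported $f:\mathbb{R}^{k-1}\to[0,\infty)$, $R_k(f,N)=\frac1N\sum_{i_1,\dots,i_k\le N\text{ distinct}}f(N(\!(y_{i_1}-y_{i_2})\!),\dots,N(\!(y_{i_1}-y_{i_k})\!))$, and $(y_n)$ has Poissonian $k$-th order correlations if $\lim_N R_k(f,N)=\int_{\mathbb{R}^{k-1}}f$ for all $f\in C_c(\mathbb{R}^{k-1})$. *)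

theory Defs
  imports "HOL-Analysis.Analysis" "HOL-Library.Landau_Symbols"
begin

definition additive_energy :: "nat set \<Rightarrow> nat" where
  "additive_energy A =
     card {(a, b, c, d). a \<in> A \<and> b \<in> A \<and> c \<in> A \<and> d \<in> A \<and> a + b = c + d}"

definition signed_dist :: "real \<Rightarrow> real" where
  "signed_dist x = (if frac x \<le> 1 / 2 then frac x else frac x - 1)"

(* The order k varies inside the statement, so R^(k-1) is modelled as the space of
   extensional functions on the index set {2..k}: a point is (z_2, ..., z_k).  The topology
   powertop_real {2..k} and the measure PiM {2..k} (\<lambda>_. lborel) both live on this carrier;
   values of f outside it play no role. *)

definition nonneg_Cc :: "nat \<Rightarrow> ((nat \<Rightarrow> real) \<Rightarrow> real) \<Rightarrow> bool" where
  "nonneg_Cc k f \<longleftrightarrow>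
     (\<forall>z \<in> topspace (powertop_real {2..k}). 0 \<le> f z) \<and>
     continuous_map (powertop_real {2..k}) euclideanreal f \<and>
     compactin (powertop_real {2..k})
       (powertop_real {2..k} closure_of {z \<in> topspace (powertop_real {2..k}). f z \<noteq> 0})"

(* Sequences are indexed from 1; their value at 0 is irrelevant. *)

definition correlation ::
    "nat \<Rightarrow> ((nat \<Rightarrow> real) \<Rightarrow> real) \<Rightarrow> (nat \<Rightarrow> real) \<Rightarrow> nat \<Rightarrow> real" where
  "correlation k f y N =
     1 / real N * (\<Sum>i \<in> {i \<in> {1..k} \<rightarrow>\<^sub>E {1..N}. inj_on i {1..k}}.
       f (\<lambda>j\<in>{2..k}. real N * signed_dist (y (i 1) - y (i j))))"

definition poissonian_correlations :: "nat \<Rightarrow> (nat \<Rightarrow> real) \<Rightarrow> bool" where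
  "poissonian_correlations k y \<longleftrightarrow>
     (\<forall>f. nonneg_Cc k f \<longrightarrow>
        (\<lambda>N. correlation k f y N)
          \<longlonglongrightarrow> integral\<^sup>L (PiM {2..k} (\<lambda>_. lborel)) f)"

end

theory Submission
  imports Defs
begin

text \<open>
  Part (ii). If \<open>E(A\<^sub>N) \<ge> c N\<^sup>3\<close>, a positive proportion of the pairs in \<open>A\<^sub>N\<close> is popular: the
  difference has at least \<open>c N / 2\<close> representations. By Cauchy--Schwarz, for every \<open>x\<close> the weighted
  number of pairs \<open>(a, b)\<close> with \<open>(a - b) x\<close> within \<open>K / N\<close> of an integer is at least its mean over
  \<open>x\<close>; the unpopular pairs have a strictly smaller mean, so on a set of \<open>x\<close> of positive measure some
  popular difference \<open>v\<close> satisfies \<open>\<parallel>v x\<parallel> < K / N\<close>. By the Vitali covering lemma, replacing \<open>K\<close> by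
  an arbitrarily small \<open>\<delta>\<close> still leaves a set of measure bounded below. For such an \<open>x\<close> there are
  \<open>c N / 2\<close> pairs of points at distance below \<open>\<delta> / N\<close>, and by the pigeonhole principle a positive
  proportion of them has a third point within \<open>S / N\<close>, where \<open>S\<close> depends on \<open>c\<close> only. So the
  triple correlation for the box of sides \<open>\<delta>\<close> and \<open>S\<close> does not tend to its integral, which is \<open>O(\<delta> S)\<close>.

  Part (i). The sequence grows geometrically except for sparse blocks of indices
  \<open>(N - 2 Q t\<^sup>2, N]\<close>, \<open>N = Q t\<^sup>3\<close>, on which it is an arithmetic progression of step \<open>D\<close>. An equation
  \<open>a + b = c + d\<close> forces two terms on opposite sides into the same block, and the block
  has length \<open>2 N / t = o(N)\<close>, which gives \<open>E = o(N\<^sup>3)\<close>. If \<open>\<parallel>q D x\<parallel> < 1 / (t\<^sup>5 Q)\<close> for some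
  \<open>q \<le> Q\<close>, the multiples \<open>q D, 2 q D, \<dots>, t\<^sup>2 q D\<close> of the step contribute at least about \<open>t\<close> to every
  correlation of order \<open>k \<ge> 2\<close>. By Dirichlet's approximation theorem and the Vitali covering lemma
  this event has probability at least a constant times \<open>t\<^sup>-\<^sup>5\<close>. With \<open>t\<close> the fifth root of the
  block number and the steps \<open>D\<close> successively divisible, the events become conditions on
  the independent digits of \<open>x\<close> in a mixed base, so almost every \<open>x\<close> lies in infinitely many of them.
\<close>

section \<open>Test functions and lower bounds for correlations\<close>

text \<open>\<open>signed_dist u\<close> is the representative of \<open>u\<close> modulo 1 in the
  interval (-1/2, 1/2], so no representative is closer to 0. Hence closeness modulo 1 is proved by
  exhibiting any suitable integer \<open>p\<close>.\<close>

lemma abs_signed_dist_le: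
  fixes u :: real and p :: int
  shows "\<bar>signed_dist u\<bar> \<le> \<bar>u - of_int p\<bar>"
proof -
  define m where "m = \<lfloor>u\<rfloor> - p"
  have e: "u - of_int p = frac u + of_int m" by (simp add: m_def frac_def)
  have f: "0 \<le> frac u" "frac u < 1" by (simp_all add: frac_lt_1)
  consider "m \<ge> 0" | "m \<le> -1" by linarith
  then show ?thesis
  proof cases
    case 1
    then have "real_of_int m \<ge> 0" by simp
    then show ?thesis using f unfolding signed_dist_def e by simp
  next
    case 2
    then have "real_of_int m \<le> -1" by linarith
    then show ?thesis using f unfolding signed_dist_def e by (auto simp: abs_if)
  qed
qed

lemma abs_signed_dist_frac_diff_le:
  fixes u v :: real and p :: int
  shows "\<bar>signed_dist (frac u - frac v)\<bar> \<le> \<bar>u - v - of_int p\<bar>"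
proof -
  have "frac u - frac v - of_int (p - \<lfloor>u\<rfloor> + \<lfloor>v\<rfloor>) = u - v - of_int p"
    by (simp add: frac_def)
  then show ?thesis using abs_signed_dist_le by metis
qed

text \<open>The height 2 makes the tent at least 1 on [-w, w], while its support is only [-2w, 2w]:
  a continuous majorant of an indicator, with integral proportional to \<open>w\<close>.\<close>

definition tent :: "real \<Rightarrow> real \<Rightarrow> real" where
  "tent w z = max 0 (2 - \<bar>z\<bar> / w)"

definition tent_prod :: "(nat \<Rightarrow> real) \<Rightarrow> nat \<Rightarrow> (nat \<Rightarrow> real) \<Rightarrow> real" where
  "tent_prod w k z = (\<Prod>i\<in>{2..k}. tent (w i) (z i))"

lemma tent_nonneg: "0 \<le> tent w z"
  by (simp add: tent_def)

lemma tent_ge_1: "w > 0 \<Longrightarrow> \<bar>z\<bar> \<le> w \<Longrightarrow> 1 \<le> tent w z"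
  by (auto simp: tent_def max_def field_simps)

lemma tent_eq_0: "w > 0 \<Longrightarrow> 2 * w < \<bar>z\<bar> \<Longrightarrow> tent w z = 0"
  by (auto simp: tent_def max_def field_simps)

lemma tent_le: "w > 0 \<Longrightarrow> tent w z \<le> 2 * indicator {-2*w..2*w} z"
  using tent_eq_0[of w z] by (cases "2 * w < \<bar>z\<bar>") (auto simp: tent_def indicator_def)

lemma continuous_tent: "continuous_on UNIV (tent w)"
  unfolding tent_def divide_inverse by (intro continuous_intros)

lemma tent_prod_nonneg: "0 \<le> tent_prod w k z"
  by (simp add: tent_prod_def tent_nonneg prod_nonneg)

lemma tent_prod_ge_1:
  assumes "\<And>i. i \<in> {2..k} \<Longrightarrow> w i > 0" "\<And>i. i \<in> {2..k} \<Longrightarrow> \<bar>z i\<bar> \<le> w i"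
  shows "1 \<le> tent_prod w k z"
  unfolding tent_prod_def by (rule prod_ge_1) (use assms tent_ge_1 in auto)

lemma nonneg_Cc_tent_prod:
  assumes w: "\<And>i. i \<in> {2..k} \<Longrightarrow> w i > 0"
  shows "nonneg_Cc k (tent_prod w k)"
proof -
  let ?X = "powertop_real {2..k}"
  let ?K = "Pi\<^sub>E {2..k} (\<lambda>i. {-2 * w i..2 * w i})"
  have cont: "continuous_map ?X euclideanreal (tent_prod w k)"
    unfolding tent_prod_def
  proof (rule continuous_map_prod)
    fix i assume i: "i \<in> {2..k}"
    have "continuous_map ?X euclideanreal (tent (w i) \<circ> (\<lambda>z. z i))"
      by (rule continuous_map_compose[OF continuous_map_product_projection[OF i]])
         (simp add: continuous_tent)
    then show "continuous_map ?X euclideanreal (\<lambda>z. tent (w i) (z i))" by (simp add: o_def)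
  qed simp
  have sub: "{z \<in> topspace ?X. tent_prod w k z \<noteq> 0} \<subseteq> ?K"
  proof clarify
    fix z assume z: "z \<in> topspace ?X" "tent_prod w k z \<noteq> 0"
    have "z i \<in> {-2 * w i..2 * w i}" if i: "i \<in> {2..k}" for i
    proof -
      have "tent (w i) (z i) \<noteq> 0" using z(2) i by (auto simp: tent_prod_def)
      then have "\<not> 2 * w i < \<bar>z i\<bar>" using tent_eq_0[OF w[OF i]] by blast
      then show ?thesis by auto
    qed
    then show "z \<in> ?K" using z(1) by (auto simp: PiE_iff)
  qed
  have "compactin ?X ?K" by (simp add: compactin_PiE)
  moreover have "closedin ?X ?K" by (simp add: closedin_product_topology)
  ultimately have "compactin ?X (?X closure_of {z \<in> topspace ?X. tent_prod w k z \<noteq> 0})"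
    using closed_compactin closure_of_minimal[OF sub] closedin_closure_of by blast
  with cont show ?thesis by (simp add: nonneg_Cc_def tent_prod_nonneg)
qed

text \<open>The integral factorizes, and each factor is at most 2 on an interval of length
  \<open>4 * w i\<close>. This crude bound suffices: only the proportionality to the widths
  matters.\<close>

lemma integral_tent_prod_le:
  assumes w: "\<And>i. i \<in> {2..k} \<Longrightarrow> w i > 0"
  shows "integral\<^sup>L (PiM {2..k} (\<lambda>_. lborel)) (tent_prod w k) \<le> (\<Prod>i\<in>{2..k}. 8 * w i)"
proof -
  interpret product_sigma_finite "\<lambda>_::nat. lborel :: real measure" ..
  have int: "integrable lborel (tent (w i)) \<and> integral\<^sup>L lborel (tent (w i)) \<le> 8 * w i"
    if i: "i \<in> {2..k}" for i
  proof -
    have g: "integrable lborel (\<lambda>z. 2 * indicator {-2*w i..2*w i} z :: real)"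
      by (intro integrable_mult_right integrable_real_indicator emeasure_bounded_finite) auto
    have m: "tent (w i) \<in> borel_measurable lborel"
      using borel_measurable_continuous_onI[OF continuous_tent] by simp
    have f: "integrable lborel (tent (w i))"
      by (rule Bochner_Integration.integrable_bound[OF g m])
         (use tent_le[OF w[OF i]] in \<open>auto simp: tent_nonneg\<close>)
    have "integral\<^sup>L lborel (tent (w i)) \<le> integral\<^sup>L lborel (\<lambda>z. 2 * indicator {-2*w i..2*w i} z)"
      by (rule integral_mono[OF f g]) (use tent_le[OF w[OF i]] in auto)
    also have "\<dots> = 8 * w i" using w[OF i] by simp
    finally show ?thesis using f by simp
  qed
  have "integral\<^sup>L (PiM {2..k} (\<lambda>_. lborel)) (tent_prod w k)
      = (\<Prod>i\<in>{2..k}. integral\<^sup>L lborel (tent (w i)))"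
    unfolding tent_prod_def by (rule product_integral_prod) (use int in auto)
  also have "\<dots> \<le> (\<Prod>i\<in>{2..k}. 8 * w i)"
    by (rule prod_mono) (use int tent_nonneg in \<open>auto intro!: integral_nonneg\<close>)
  finally show ?thesis .
qed

text \<open>All terms of the correlation sum are nonnegative and each tuple in \<open>T\<close>
  contributes at least 1, so exhibiting many close tuples bounds the correlation from below.\<close>

lemma correlation_tent_prod_ge:
  assumes w: "\<And>i. i \<in> {2..k} \<Longrightarrow> w i > 0"
    and T: "T \<subseteq> {i \<in> {1..k} \<rightarrow>\<^sub>E {1..N}. inj_on i {1..k}}"
    and close: "\<And>i j. i \<in> T \<Longrightarrow> j \<in> {2..k} \<Longrightarrow> real N * \<bar>signed_dist (y (i 1) - y (i j))\<bar> \<le> w j"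
  shows "real (card T) / real N \<le> correlation k (tent_prod w k) y N"
proof -
  let ?S = "{i \<in> {1..k} \<rightarrow>\<^sub>E {1..N}. inj_on i {1..k}}"
  let ?g = "\<lambda>i. tent_prod w k (\<lambda>j\<in>{2..k}. real N * signed_dist (y (i 1) - y (i j)))"
  have fin: "finite ?S"
    by (rule finite_subset[of _ "{1..k} \<rightarrow>\<^sub>E {1..N}"]) (auto intro!: finite_PiE)
  have "real (card T) = (\<Sum>i\<in>T. 1)" by simp
  also have "\<dots> \<le> (\<Sum>i\<in>T. ?g i)"
    by (rule sum_mono, rule tent_prod_ge_1) (use w close in \<open>auto simp: abs_mult\<close>)
  also have "\<dots> \<le> (\<Sum>i\<in>?S. ?g i)"
    by (rule sum_mono2[OF fin T]) (simp add: tent_prod_nonneg)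
  finally show ?thesis unfolding correlation_def by (simp add: divide_right_mono)
qed

section \<open>Approximation by multiples and Vitali covering\<close>

definition near_multiples :: "nat set \<Rightarrow> real \<Rightarrow> real set" where
  "near_multiples V r = {x \<in> {0..1}. \<exists>v\<in>V. \<exists>p::int. \<bar>real v * x - of_int p\<bar> < r}"

text \<open>Dividing by \<open>v\<close> turns the condition into closeness to the fraction p/v; for
  \<open>x\<close> in [0, 1] and \<open>r \<le> 1\<close> the integer \<open>p\<close> has to lie
  between 0 and \<open>v\<close>. A finite \<open>V\<close> thus gives finitely many balls.\<close>

lemma near_multiples_eq_balls:
  assumes V: "0 \<notin> V" and r: "r \<le> 1"
  shows "near_multiples V r =
    {0..1} \<inter> (\<Union>(v, p)\<in>(SIGMA v:V. {..v}). ball (real p / real v) (r / real v))"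
proof (intro set_eqI iffI)
  fix x assume "x \<in> near_multiples V r"
  then obtain v p where x: "x \<in> {0..1}" and v: "v \<in> V" and p: "\<bar>real v * x - of_int (p::int)\<bar> < r"
    by (auto simp: near_multiples_def)
  have v0: "real v > 0" using V v by (cases "v = 0") auto
  have "0 \<le> real v * x" "real v * x \<le> real v" using x v0 by (auto simp: mult_left_le)
  then have "real_of_int p > -1" "real_of_int p < real v + 1" using p r by linarith+
  then have p0: "0 \<le> p" "nat p \<le> v" by linarith+
  have "\<bar>x - real (nat p) / real v\<bar> < r / real v"
  proof -
    have "x - real (nat p) / real v = (real v * x - of_int p) / real v"
      using v0 p0 by (simp add: field_simps)
    then show ?thesis using p v0 by (simp add: abs_divide divide_strict_right_mono)
  qed
  then have "x \<in> ball (real (nat p) / real v) (r / real v)"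
    by (simp add: dist_real_def abs_minus_commute)
  then show "x \<in> {0..1} \<inter> (\<Union>(v, p)\<in>(SIGMA v:V. {..v}). ball (real p / real v) (r / real v))"
    using x v p0 by force
next
  fix x assume "x \<in> {0..1} \<inter> (\<Union>(v, p)\<in>(SIGMA v:V. {..v}). ball (real p / real v) (r / real v))"
  then obtain v p where x: "x \<in> {0..1}" and v: "v \<in> V" and "p \<le> v"
    and p: "\<bar>x - real p / real v\<bar> < r / real v"
    by (auto simp: dist_real_def abs_minus_commute)
  have v0: "real v > 0" using V v by (cases "v = 0") auto
  have "real v * x - of_int (int p) = real v * (x - real p / real v)"
    using v0 by (simp add: field_simps)
  then have "\<bar>real v * x - of_int (int p)\<bar> < r"
    using p v0 by (simp add: abs_mult pos_less_divide_eq mult.commute)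
  then show "x \<in> near_multiples V r" using x v unfolding near_multiples_def by blast
qed

lemma near_multiples_sets [measurable]:
  assumes V: "0 \<notin> V" and r: "r \<le> 1"
  shows "near_multiples V r \<in> sets borel"
proof -
  have "(\<Union>(v, p)\<in>(SIGMA v:V. {..v}). ball (real p / real v) (r / real v)) \<in> sets borel"
    by (intro borel_open open_UN) auto
  then show ?thesis unfolding near_multiples_eq_balls[OF V r] by (intro sets.Int) auto
qed

lemma near_multiples_subset: "near_multiples V r \<subseteq> {0..1}"
  by (auto simp: near_multiples_def)

lemma bounded_fmeasurable_lborel:
  fixes A :: "real set"
  shows "A \<in> sets borel \<Longrightarrow> bounded A \<Longrightarrow> A \<in> fmeasurable lborel"
  using emeasure_bounded_finite[of A] by (simp add: fmeasurable_def)

text \<open>Vitali's lemma selects disjoint balls whose fivefold enlargements cover the set, so its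
  measure is at most 10 times the sum of their radii. The selected balls stay disjoint when shrunk
  by \<open>\<kappa>\<close>, and each keeps at least its new radius inside [0, 1]. The loss is
  linear in \<open>\<kappa>\<close> and independent of \<open>V\<close>.\<close>

lemma measure_near_multiples_shrink:
  assumes V: "0 \<notin> V" and fin: "finite V"
    and r: "0 < r" "r \<le> 1" and \<kappa>: "0 < \<kappa>" "\<kappa> \<le> 1"
  shows "\<kappa> / 10 * measure lborel (near_multiples V r) \<le> measure lborel (near_multiples V (\<kappa> * r))"
proof -
  define K where "K = (SIGMA v:V. {..v})"
  define c where "c = (\<lambda>(v, p). real p / real v)"
  define s where "s = (\<lambda>(v, p::nat). r / real v)"
  have finK: "finite K" using fin by (auto simp: K_def)
  have s: "0 < s i \<and> s i \<le> 1" if "i \<in> K" for i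
  proof -
    obtain v p where i: "i = (v, p)" by fastforce
    with that have "v \<in> V" by (simp add: K_def)
    then have "1 \<le> real v" using V by (cases "v = 0") auto
    then show ?thesis using r i by (simp add: s_def field_simps)
  qed
  have c: "c i \<in> {0..1}" if "i \<in> K" for i
    using that by (auto simp: K_def c_def divide_simps)
  have N: "near_multiples V (q * r) = {0..1} \<inter> (\<Union>i\<in>K. ball (c i) (q * s i))" if "q \<le> 1" for q
  proof -
    have "q * r \<le> 1" using that r by (smt (verit) mult_left_le_one_le mult_nonneg_nonpos2)
    then show ?thesis
      unfolding near_multiples_eq_balls[OF V \<open>q * r \<le> 1\<close>] K_def[symmetric]
      by (auto simp: c_def s_def case_prod_beta)
  qed
  have "near_multiples V r = {0..1} \<inter> (\<Union>i\<in>K. ball (c i) (s i))" using N[of 1] by simp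
  then have sub: "near_multiples V r \<subseteq> (\<Union>i\<in>K. ball (c i) (s i))" by (metis Int_lower2)
  obtain C where C: "C \<subseteq> K"
    and disj: "pairwise (\<lambda>i j. disjnt (ball (c i) (s i)) (ball (c j) (s j))) C"
    and cov: "near_multiples V r \<subseteq> (\<Union>i\<in>C. ball (c i) (5 * s i))"
    by (rule Vitali_covering_lemma_balls[OF sub, of 1]) (simp_all add: s)
  have finC: "finite C" using C finK finite_subset by blast
  have "measure lborel (near_multiples V r) \<le> measure lborel (\<Union>i\<in>C. ball (c i) (5 * s i))"
    by (rule measure_mono_fmeasurable[OF cov])
       (use finC near_multiples_sets[OF V] r in \<open>auto intro!: bounded_fmeasurable_lborel bounded_UN\<close>)
  also have "\<dots> \<le> (\<Sum>i\<in>C. measure lborel (ball (c i) (5 * s i)))"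
    by (rule measure_UNION_le) (use finC in auto)
  also have "\<dots> = (\<Sum>i\<in>C. 10 * s i)"
  proof (rule sum.cong)
    fix i assume "i \<in> C"
    then have "0 < s i" using s C by blast
    then show "measure lborel (ball (c i) (5 * s i)) = 10 * s i"
      by (simp add: ball_eq_greaterThanLessThan)
  qed simp
  finally have 1: "measure lborel (near_multiples V r) \<le> 10 * (\<Sum>i\<in>C. s i)"
    by (simp add: sum_distrib_left)
  let ?J = "\<lambda>i. {0..1} \<inter> ball (c i) (\<kappa> * s i)"
  \<comment> \<open>The centre lies in [0, 1] but the ball may stick out. An interval as long as the
    radius stays inside: it extends from the centre towards the farther endpoint, or fills the space
    next to that endpoint if the radius reaches beyond it.\<close>
  have J: "\<kappa> * s i \<le> measure lborel (?J i)" if i: "i \<in> C" for i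
  proof -
    have ks: "0 < \<kappa> * s i" "\<kappa> * s i \<le> 1"
      using s[of i] C i \<kappa> by (auto intro!: mult_le_one)
    have "\<exists>a. {a<..<a + \<kappa> * s i} \<subseteq> ?J i"
    proof (cases "c i \<le> 1/2")
      case True
      show ?thesis
      proof (cases "c i + \<kappa> * s i \<le> 1")
        case True
        then show ?thesis using c[of i] C i ks
          by (intro exI[of _ "c i"]) (auto simp: ball_eq_greaterThanLessThan)
      next
        case False
        then show ?thesis using c[of i] C i ks \<open>c i \<le> 1/2\<close>
          by (intro exI[of _ "1 - \<kappa> * s i"]) (auto simp: ball_eq_greaterThanLessThan)
      qed
    next
      case False
      show ?thesis
      proof (cases "c i - \<kappa> * s i \<ge> 0")
        case True
        then show ?thesis using c[of i] C i ks
          by (intro exI[of _ "c i - \<kappa> * s i"]) (auto simp: ball_eq_greaterThanLessThan)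
      next
        case f: False
        then show ?thesis using c[of i] C i ks False
          by (intro exI[of _ 0]) (auto simp: ball_eq_greaterThanLessThan)
      qed
    qed
    then obtain a where "{a<..<a + \<kappa> * s i} \<subseteq> ?J i" ..
    then have "measure lborel {a<..<a + \<kappa> * s i} \<le> measure lborel (?J i)"
      by (rule measure_mono_fmeasurable)
         (auto intro!: bounded_fmeasurable_lborel)
    then show ?thesis using ks by simp
  qed
  have "\<kappa> * (\<Sum>i\<in>C. s i) = (\<Sum>i\<in>C. \<kappa> * s i)" by (simp add: sum_distrib_left)
  also have "\<dots> \<le> (\<Sum>i\<in>C. measure lborel (?J i))" by (rule sum_mono) (rule J)
  also have "\<dots> = measure lborel (\<Union>i\<in>C. ?J i)"
  proof (rule measure_finite_Union[symmetric])
    show "disjoint_family_on ?J C"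
      unfolding disjoint_family_on_def
    proof (intro ballI impI)
      fix i j assume ij: "i \<in> C" "j \<in> C" "i \<noteq> j"
      have "ball (c l) (\<kappa> * s l) \<subseteq> ball (c l) (s l)" if "l \<in> C" for l
        using s[of l] C that \<kappa> by (intro subset_ball mult_left_le_one_le) auto
      then have "ball (c i) (\<kappa> * s i) \<subseteq> ball (c i) (s i)" "ball (c j) (\<kappa> * s j) \<subseteq> ball (c j) (s j)"
        using ij by auto
      moreover have "disjnt (ball (c i) (s i)) (ball (c j) (s j))"
        using disj ij by (auto simp: pairwise_def)
      ultimately show "?J i \<inter> ?J j = {}" unfolding disjnt_def by blast
    qed
    show "emeasure lborel (?J i) \<noteq> \<infinity>" if "i \<in> C" for i
      using emeasure_bounded_finite[of "?J i"] by (simp add: less_top bounded_Int)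
  qed (use finC in auto)
  also have "\<dots> \<le> measure lborel (near_multiples V (\<kappa> * r))"
  proof (rule measure_mono_fmeasurable)
    show "(\<Union>i\<in>C. ?J i) \<subseteq> near_multiples V (\<kappa> * r)" using N[OF \<kappa>(2)] C by auto
    have "near_multiples V (\<kappa> * r) \<in> sets borel"
      using near_multiples_sets[OF V, of "\<kappa> * r"] r \<kappa> by (simp add: mult_le_one)
    moreover have "bounded (near_multiples V (\<kappa> * r))"
      using near_multiples_subset bounded_closed_interval bounded_subset by blast
    ultimately show "near_multiples V (\<kappa> * r) \<in> fmeasurable lborel"
      using emeasure_bounded_finite[of "near_multiples V (\<kappa> * r)"] by (simp add: fmeasurable_def)
  qed (use finC in auto)
  finally have 2: "\<kappa> * (\<Sum>i\<in>C. s i) \<le> measure lborel (near_multiples V (\<kappa> * r))" .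
  have "\<kappa> / 10 * measure lborel (near_multiples V r) \<le> \<kappa> / 10 * (10 * (\<Sum>i\<in>C. s i))"
    using 1 \<kappa> by (intro mult_left_mono) auto
  with 2 show ?thesis by simp
qed

section \<open>Averaging over close pairs\<close>

text \<open>After translation by the integer part of \<open>c\<close> the interval is [\<theta>, 1 +
  \<theta>); the piece beyond 1 is moved back by one period to fill [0, \<theta>).\<close>

lemma nn_integral_periodic_shift:
  fixes g :: "real \<Rightarrow> ennreal"
  assumes [measurable]: "g \<in> borel_measurable borel" and per: "\<And>x (n::int). g (of_int n + x) = g x"
  shows "(\<integral>\<^sup>+x. g x * indicator {c..<c+1} x \<partial>lborel) = (\<integral>\<^sup>+x. g x * indicator {0..<1} x \<partial>lborel)"
proof -
  obtain m :: int and \<theta> where c: "c = of_int m + \<theta>" and \<theta>: "0 \<le> \<theta>" "\<theta> < 1"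
    by (rule that[of "\<lfloor>c\<rfloor>" "frac c"]) (simp add: frac_def, simp_all add: frac_lt_1)
  have "(\<integral>\<^sup>+x. g x * indicator {c..<c+1} x \<partial>lborel)
      = (\<integral>\<^sup>+x. g (of_int m + 1 * x) * indicator {c..<c+1} (of_int m + 1 * x) \<partial>lborel)"
    by (subst nn_integral_real_affine[where t="of_int m" and c=1]) simp_all
  also have "\<dots> = (\<integral>\<^sup>+x. g x * indicator {\<theta>..<1} x + g x * indicator {1..<1 + \<theta>} x \<partial>lborel)"
  proof (rule nn_integral_cong)
    fix x
    have "x \<in> {\<theta>..<1} \<union> {1..<1 + \<theta>} \<longleftrightarrow> of_int m + 1 * x \<in> {c..<c+1}"
      using \<theta> c by auto
    then show "g (of_int m + 1 * x) * indicator {c..<c+1} (of_int m + 1 * x)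
        = g x * indicator {\<theta>..<1} x + g x * indicator {1..<1 + \<theta>} x"
      by (auto simp: indicator_def per)
  qed
  also have "\<dots> = (\<integral>\<^sup>+x. g x * indicator {\<theta>..<1} x \<partial>lborel) + (\<integral>\<^sup>+x. g x * indicator {1..<1 + \<theta>} x \<partial>lborel)"
    by (rule nn_integral_add) simp_all
  also have "(\<integral>\<^sup>+x. g x * indicator {1..<1 + \<theta>} x \<partial>lborel)
      = (\<integral>\<^sup>+x. g (of_int 1 + 1 * x) * indicator {1..<1 + \<theta>} (of_int 1 + 1 * x) \<partial>lborel)"
    by (subst nn_integral_real_affine[where t="of_int 1" and c=1]) simp_all
  also have "\<dots> = (\<integral>\<^sup>+x. g x * indicator {0..<\<theta>} x \<partial>lborel)"
    unfolding per by (intro nn_integral_cong) (auto simp: indicator_def)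
  also have "(\<integral>\<^sup>+x. g x * indicator {\<theta>..<1} x \<partial>lborel) + (\<integral>\<^sup>+x. g x * indicator {0..<\<theta>} x \<partial>lborel)
      = (\<integral>\<^sup>+x. g x * indicator {\<theta>..<1} x + g x * indicator {0..<\<theta>} x \<partial>lborel)"
    by (rule nn_integral_add[symmetric]) simp_all
  also have "\<dots> = (\<integral>\<^sup>+x. g x * indicator {0..<1} x \<partial>lborel)"
    using \<theta> by (intro nn_integral_cong) (auto simp: indicator_def)
  finally show ?thesis .
qed

abbreviation unif :: "real measure" where
  "unif \<equiv> restrict_space lborel {0..<1}"

lemma nn_integral_unif: "(\<integral>\<^sup>+x. f x \<partial>unif) = (\<integral>\<^sup>+x. f x * indicator {0..<1} x \<partial>lborel)"
  by (simp add: nn_integral_restrict_space)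

lemma emeasure_unif_space: "emeasure unif {0..<1} = 1"
  by (simp add: emeasure_restrict_space)

lemma sigma_finite_unif: "sigma_finite_measure unif"
  by (rule sigma_finite_measure_restrict_space) (auto intro: lborel.sigma_finite_measure_axioms)

text \<open>The substitution stretches [0, 1) over exactly \<open>v\<close> periods, and its
  Jacobian divides by \<open>v\<close>. In probabilistic terms, \<open>c + v x\<close> modulo 1 is
  again uniformly distributed.\<close>

lemma nn_integral_unif_periodic_affine:
  fixes g :: "real \<Rightarrow> ennreal" and v :: nat
  assumes [measurable]: "g \<in> borel_measurable borel" and per: "\<And>x (n::int). g (of_int n + x) = g x"
    and v: "0 < v"
  shows "(\<integral>\<^sup>+x. g (c + real v * x) \<partial>unif) = (\<integral>\<^sup>+x. g x \<partial>unif)"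
proof -
  let ?I = "\<integral>\<^sup>+x. g x * indicator {0..<1} x \<partial>lborel"
  have "(\<integral>\<^sup>+x. g x * indicator {c..<c+real m} x \<partial>lborel) = of_nat m * ?I" for m
  proof (induction m)
    case (Suc m)
    have "(\<integral>\<^sup>+x. g x * indicator {c..<c+real (Suc m)} x \<partial>lborel)
      = (\<integral>\<^sup>+x. g x * indicator {c..<c+real m} x + g x * indicator {c+real m..<c+real m+1} x \<partial>lborel)"
      by (intro nn_integral_cong) (auto simp: indicator_def)
    also have "\<dots> = (\<integral>\<^sup>+x. g x * indicator {c..<c+real m} x \<partial>lborel) + ?I"
      by (subst nn_integral_add) (simp_all add: nn_integral_periodic_shift per)
    finally show ?case by (simp add: Suc algebra_simps)
  qed simp
  then have "of_nat v * ?I = (\<integral>\<^sup>+x. g x * indicator {c..<c+real v} x \<partial>lborel)" by simp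
  also have "\<dots> = ennreal \<bar>real v\<bar> * (\<integral>\<^sup>+x. g (c + real v * x) * indicator {c..<c+real v} (c + real v * x) \<partial>lborel)"
    by (subst nn_integral_real_affine[where t=c and c="real v"]) (use v in simp_all)
  also have "(\<integral>\<^sup>+x. g (c + real v * x) * indicator {c..<c+real v} (c + real v * x) \<partial>lborel)
      = (\<integral>\<^sup>+x. g (c + real v * x) * indicator {0..<1} x \<partial>lborel)"
    using v by (intro nn_integral_cong) (auto simp: indicator_def zero_le_mult_iff)
  finally have "of_nat v * ?I = of_nat v * (\<integral>\<^sup>+x. g (c + real v * x) * indicator {0..<1} x \<partial>lborel)"
    by (simp add: ennreal_of_nat_eq_real_of_nat)
  then have "?I = (\<integral>\<^sup>+x. g (c + real v * x) * indicator {0..<1} x \<partial>lborel)"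
    using v by (subst (asm) ennreal_mult_cancel_left) auto
  then show ?thesis by (simp add: nn_integral_unif)
qed

text \<open>The indicator of the arc [0, 1/M) of the circle R/Z, lifted to a periodic function on
  the line.\<close>

definition arc :: "nat \<Rightarrow> real \<Rightarrow> ennreal" where
  "arc M u = indicator {u. frac u < 1 / real M} u"

lemma arc_measurable [measurable]: "arc M \<in> borel_measurable borel"
  unfolding arc_def frac_def by measurable

lemma arc_periodic: "arc M (of_int n + x) = arc M x"
  by (simp add: arc_def indicator_def frac_def)

lemma arc_idem: "arc M u * arc M u = arc M u"
  by (simp add: arc_def indicator_def)

lemma nn_integral_arc:
  assumes "0 < M"
  shows "(\<integral>\<^sup>+t. arc M t \<partial>unif) = ennreal (1 / real M)"
proof -
  have *: "arc M t * indicator {0..<1} t = indicator {0..<1 / real M} t" for t :: real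
  proof -
    have "1 / real M \<le> 1" using assms by simp
    then have "t < 1" if "t < 1 / real M" using that by linarith
    moreover have "frac t = t" if "0 \<le> t" "t < 1" using that by (simp add: frac_eq)
    ultimately show ?thesis by (auto simp: arc_def indicator_def)
  qed
  show ?thesis unfolding nn_integral_unif * by simp
qed

lemma arc_mult_eq_0:
  assumes "\<And>p::int. 1 / real M \<le> \<bar>u - v - of_int p\<bar>"
  shows "arc M u * arc M v = 0"
proof (rule ccontr)
  assume "arc M u * arc M v \<noteq> 0"
  then have "frac u < 1 / real M" "frac v < 1 / real M"
    by (auto simp: arc_def indicator_def split: if_splits)
  moreover have "0 \<le> frac u" "0 \<le> frac v" by simp_all
  ultimately have "\<bar>frac u - frac v\<bar> < 1 / real M" by linarith
  moreover have "u - v - of_int (\<lfloor>u\<rfloor> - \<lfloor>v\<rfloor>) = frac u - frac v" by (simp add: frac_def)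
  ultimately show False using assms[of "\<lfloor>u\<rfloor> - \<lfloor>v\<rfloor>"] by linarith
qed

text \<open>Pairwise independence under random \<open>x\<close> and \<open>t\<close>: translating
  \<open>t\<close> removes the smaller of \<open>a x\<close> and \<open>b x\<close>. After
  exchanging the integrals, the inner one over \<open>x\<close> equals 1/M for every
  \<open>t\<close>, because \<open>b - a\<close> is a nonzero integer.\<close>

lemma nn_integral_arc_mult:
  fixes a b :: nat
  assumes M: "0 < M" and "a \<noteq> b"
  shows "(\<integral>\<^sup>+x. \<integral>\<^sup>+t. arc M (real a * x + t) * arc M (real b * x + t) \<partial>unif \<partial>unif)
    = ennreal (1 / real M ^ 2)"
  using assms(2)
proof (induction a b rule: linorder_wlog)
  case (le a b)
  interpret U: sigma_finite_measure unif by (rule sigma_finite_unif)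
  interpret pair_sigma_finite unif unif ..
  have [measurable]: "(\<lambda>x. x) \<in> measurable unif borel"
    by (simp add: measurable_restrict_space1)
  have b: "real b = real a + real (b - a)" using le by simp
  have "(\<integral>\<^sup>+t. arc M (real a * x + t) * arc M (real b * x + t) \<partial>unif)
      = (\<integral>\<^sup>+t. arc M t * arc M (t + real (b - a) * x) \<partial>unif)" for x
  proof -
    let ?g = "\<lambda>t. arc M t * arc M (t + real (b - a) * x)"
    have "(\<integral>\<^sup>+t. ?g (real a * x + real 1 * t) \<partial>unif) = (\<integral>\<^sup>+t. ?g t \<partial>unif)"
      by (rule nn_integral_unif_periodic_affine) (simp_all add: arc_periodic add.assoc)
    then show ?thesis by (simp add: b algebra_simps)
  qed
  then have "(\<integral>\<^sup>+x. \<integral>\<^sup>+t. arc M (real a * x + t) * arc M (real b * x + t) \<partial>unif \<partial>unif)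
      = (\<integral>\<^sup>+x. \<integral>\<^sup>+t. arc M t * arc M (t + real (b - a) * x) \<partial>unif \<partial>unif)" by simp
  also have "\<dots> = (\<integral>\<^sup>+t. \<integral>\<^sup>+x. arc M t * arc M (t + real (b - a) * x) \<partial>unif \<partial>unif)"
    by (rule Fubini'[symmetric]) measurable
  also have "\<dots> = (\<integral>\<^sup>+t. arc M t * (\<integral>\<^sup>+x. arc M (t + real (b - a) * x) \<partial>unif) \<partial>unif)"
    by (subst nn_integral_cmult) (simp_all, measurable)
  also have "\<dots> = (\<integral>\<^sup>+t. arc M t * ennreal (1 / real M) \<partial>unif)"
    using le by (subst nn_integral_unif_periodic_affine) (simp_all add: arc_periodic nn_integral_arc M)
  also have "\<dots> = ennreal (1 / real M) * ennreal (1 / real M)"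
    by (subst nn_integral_multc) (simp_all add: nn_integral_arc M)
  also have "\<dots> = ennreal (1 / real M ^ 2)"
    by (simp add: ennreal_mult[symmetric] power2_eq_square)
  finally show ?case .
qed (simp add: mult.commute)

text \<open>A subtraction-free form of \<open>(S - s)^2 \<ge> 0\<close>. Integrated with
  \<open>s\<close> the mean of \<open>S\<close>, it yields Cauchy--Schwarz.\<close>

lemma ennreal_two_mult_le:
  fixes s S :: ennreal
  shows "2 * (s * S) \<le> S * S + s * s"
proof (cases s; cases S)
  fix r q assume s: "s = ennreal r" "0 \<le> r" "S = ennreal q" "0 \<le> q"
  have "2 * (r * q) \<le> q * q + r * r" using sum_squares_bound[of r q] by (simp add: power2_eq_square)
  then have "ennreal (2 * (r * q)) \<le> ennreal (q * q + r * r)" by (rule ennreal_leI)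
  then show ?thesis using s by (simp add: ennreal_mult ennreal_plus)
qed (auto simp: ennreal_top_mult)

text \<open>For fixed \<open>x\<close>, the number of points \<open>a x + t\<close> in an arc of
  length 1/M has mean \<open>s = card A / M\<close> over \<open>t\<close>, so its second moment is
  at least \<open>s * s\<close>. In the expanded square the diagonal gives \<open>s\<close>, and the
  pairs in \<open>P\<close> give nothing when \<open>x\<close> is in \<open>G\<close>. Integrating
  over \<open>x\<close> and multiplying by \<open>M ^ 2\<close> gives the bound.\<close>

lemma measure_avoiding_close_pairs_le:
  fixes A :: "nat set" and P :: "(nat \<times> nat) set"
  assumes fin: "finite A" and P: "P \<subseteq> A \<times> A" "\<And>a. (a, a) \<notin> P" and M: "0 < M"
    and G: "G \<in> sets borel" "G \<subseteq> {0..<1}"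
    and far: "\<And>x a b (p::int). x \<in> G \<Longrightarrow> (a, b) \<in> P \<Longrightarrow> 1 / real M \<le> \<bar>real a * x - real b * x - of_int p\<bar>"
  shows "real (card A) ^ 2 * measure lborel G \<le> real M * real (card A) + real (card A) ^ 2 - real (card P)"
proof -
  interpret U: sigma_finite_measure unif by (rule sigma_finite_unif)
  have [measurable]: "(\<lambda>x. x) \<in> measurable unif borel"
    by (simp add: measurable_restrict_space1)
  define s where "s = ennreal (real (card A) / real M)"
  define R where "R = A \<times> A - Id - P"
  let ?h = "\<lambda>a b x. \<integral>\<^sup>+t. arc M (real a * x + t) * arc M (real b * x + t) \<partial>unif"
  define D where "D = (\<lambda>a. (a, a)) ` A"
  have finR: "finite R" and finD: "finite D" and finP: "finite P"
    using fin finite_subset[OF P(1)] by (auto simp: R_def D_def)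
  have AA: "A \<times> A = R \<union> (D \<union> P)" using P by (auto simp: R_def D_def)
  have one: "(\<integral>\<^sup>+t. arc M (c + t) \<partial>unif) = ennreal (1 / real M)" for c
    using nn_integral_unif_periodic_affine[of "arc M" 1 c] by (simp add: arc_periodic nn_integral_arc M)
  have sum1: "of_nat (card A) * ennreal (1 / real M) = s"
    by (simp add: s_def ennreal_of_nat_eq_real_of_nat ennreal_mult[symmetric])
  have key: "s * s \<le> s + (\<Sum>(a, b)\<in>R. ?h a b x)" if x: "x \<in> G" for x
  proof -
    let ?S = "\<lambda>t. \<Sum>a\<in>A. arc M (real a * x + t)"
    have "2 * (s * s) = 2 * (s * (\<integral>\<^sup>+t. ?S t \<partial>unif))"
      by (subst nn_integral_sum) (simp_all add: one sum1)
    also have "\<dots> = (\<integral>\<^sup>+t. 2 * (s * ?S t) \<partial>unif)"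
      by (simp add: nn_integral_cmult)
    also have "\<dots> \<le> (\<integral>\<^sup>+t. ?S t * ?S t + s * s \<partial>unif)"
      by (intro nn_integral_mono ennreal_two_mult_le)
    also have "\<dots> = (\<integral>\<^sup>+t. ?S t * ?S t \<partial>unif) + s * s"
      by (subst nn_integral_add) (simp_all add: emeasure_unif_space)
    finally have "s * s + s * s \<le> s * s + (\<integral>\<^sup>+t. ?S t * ?S t \<partial>unif)"
      by (simp only: mult_2 add.commute)
    \<comment> \<open>Cancellation in \<open>ennreal\<close> has an infinite alternative, excluded
      because \<open>s\<close> is real.\<close>
    then have "s * s = \<infinity> \<or> s * s \<le> (\<integral>\<^sup>+t. ?S t * ?S t \<partial>unif)"
      by (simp only: ennreal_add_left_cancel_le)
    moreover have "s * s \<noteq> \<infinity>" by (simp add: s_def ennreal_mult[symmetric])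
    ultimately have "s * s \<le> (\<integral>\<^sup>+t. ?S t * ?S t \<partial>unif)" by blast
    also have "\<dots> = (\<integral>\<^sup>+t. (\<Sum>(a, b)\<in>A \<times> A. arc M (real a * x + t) * arc M (real b * x + t)) \<partial>unif)"
      by (simp add: sum_product sum.cartesian_product)
    also have "\<dots> = (\<Sum>(a, b)\<in>A \<times> A. ?h a b x)"
      by (subst nn_integral_sum) (simp_all add: case_prod_beta)
    also have "\<dots> = (\<Sum>(a, b)\<in>R. ?h a b x) + (\<Sum>(a, b)\<in>D \<union> P. ?h a b x)"
      unfolding AA by (rule sum.union_disjoint) (use finR finD finP P in \<open>auto simp: R_def D_def\<close>)
    also have "(\<Sum>(a, b)\<in>D \<union> P. ?h a b x) = (\<Sum>(a, b)\<in>D. ?h a b x) + (\<Sum>(a, b)\<in>P. ?h a b x)"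
      by (rule sum.union_disjoint) (use finD finP P in \<open>auto simp: D_def\<close>)
    also have "(\<Sum>(a, b)\<in>P. ?h a b x) = 0"
    proof (rule sum.neutral, clarify)
      fix a b assume "(a, b) \<in> P"
      then have "arc M (real a * x + t) * arc M (real b * x + t) = 0" for t
        using far[OF x] by (intro arc_mult_eq_0) (simp add: algebra_simps)
      then show "?h a b x = 0" by (simp only: nn_integral_const mult_zero_left)
    qed
    also have "(\<Sum>(a, b)\<in>D. ?h a b x) = s"
      unfolding D_def by (subst sum.reindex) (auto simp: inj_on_def arc_idem one sum1)
    finally show ?thesis by (simp add: add.commute)
  qed
  have G': "G \<in> sets unif" using G by (auto simp: sets_restrict_space_iff)
  have "s * s * emeasure lborel G = (\<integral>\<^sup>+x. s * s * indicator G x \<partial>unif)"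
    using G G' by (subst nn_integral_cmult_indicator) (auto simp: emeasure_restrict_space)
  \<comment> \<open>On the right the integration extends to all of [0, 1), where every off-diagonal
    pair has the exact mean \<open>1 / M ^ 2\<close>.\<close>
  also have "\<dots> \<le> (\<integral>\<^sup>+x. s + (\<Sum>(a, b)\<in>R. ?h a b x) \<partial>unif)"
    using key by (intro nn_integral_mono) (auto simp: indicator_def)
  also have "\<dots> = s + (\<Sum>(a, b)\<in>R. \<integral>\<^sup>+x. ?h a b x \<partial>unif)"
    by (subst nn_integral_add) (simp_all add: emeasure_unif_space nn_integral_sum case_prod_beta)
  also have "(\<Sum>(a, b)\<in>R. \<integral>\<^sup>+x. ?h a b x \<partial>unif) = (\<Sum>(a, b)\<in>R. ennreal (1 / real M ^ 2))"
  proof (rule sum.cong)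
    fix z assume "z \<in> R"
    then obtain a b where "z = (a, b)" "a \<noteq> b" by (cases z) (auto simp: R_def)
    then show "(case z of (a, b) \<Rightarrow> \<integral>\<^sup>+x. ?h a b x \<partial>unif) = (case z of (a, b) \<Rightarrow> ennreal (1 / real M ^ 2))"
      using nn_integral_arc_mult[OF M] by simp
  qed simp
  also have "\<dots> = ennreal (real (card R) / real M ^ 2)"
    by (simp add: ennreal_of_nat_eq_real_of_nat ennreal_mult[symmetric])
  finally have "s * s * emeasure lborel G \<le> s + ennreal (real (card R) / real M ^ 2)" .
  moreover have "emeasure lborel G = ennreal (measure lborel G)"
  proof -
    have "emeasure lborel G \<le> emeasure lborel {0..<1::real}" using G by (intro emeasure_mono) auto
    then have "emeasure lborel G \<noteq> top" by (auto simp: top_unique)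
    then show ?thesis by (simp add: emeasure_eq_ennreal_measure)
  qed
  ultimately have "(real (card A) / real M) * (real (card A) / real M) * measure lborel G
      \<le> real (card A) / real M + real (card R) / real M ^ 2"
    by (simp add: s_def ennreal_mult[symmetric] ennreal_plus[symmetric] del: ennreal_plus)
  then have "real (card A) ^ 2 * measure lborel G \<le> real M * real (card A) + real (card R)"
    using M by (simp add: field_simps power2_eq_square)
  moreover have "card R + card P \<le> card A ^ 2"
  proof -
    have "card R + card P = card (R \<union> P)"
      by (rule card_Un_disjoint[symmetric, OF finR finP]) (auto simp: R_def)
    also have "\<dots> \<le> card (A \<times> A)" using fin P by (intro card_mono) (auto simp: R_def)
    finally show ?thesis by (simp add: card_cartesian_product power2_eq_square)
  qed
  then have "real (card R) + real (card P) \<le> real (card A) ^ 2"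
    by (metis of_nat_add of_nat_le_iff of_nat_power)
  ultimately show ?thesis by linarith
qed

section \<open>Popular differences\<close>

definition rep_count :: "nat set \<Rightarrow> nat \<Rightarrow> nat" where
  "rep_count A v = card {(p, q). p \<in> A \<and> q \<in> A \<and> p = q + v}"

text \<open>With truncated subtraction, \<open>(a - b) + (b - a)\<close> is the absolute
  difference.\<close>

definition popular_pairs :: "nat set \<Rightarrow> real \<Rightarrow> (nat \<times> nat) set" where
  "popular_pairs A \<theta> = {(a, b). a \<in> A \<and> b \<in> A \<and> a \<noteq> b \<and> \<theta> \<le> real (rep_count A ((a - b) + (b - a)))}"

text \<open>The quadruples are grouped by the pair \<open>(a, c)\<close>; the remaining
  \<open>(b, d)\<close> then has a prescribed difference. Such a fibre has at most
  \<open>card A\<close> elements, used for diagonal and popular pairs, and at most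
  \<open>\<theta>\<close> elements for every other pair.\<close>

lemma additive_energy_le_popular_pairs:
  assumes fin: "finite A" and \<theta>: "0 \<le> \<theta>"
  shows "real (additive_energy A) \<le> real (card A) ^ 2 + real (card (popular_pairs A \<theta>)) * real (card A)
    + real (card A) ^ 2 * \<theta>"
proof -
  let ?N = "card A" and ?P = "popular_pairs A \<theta>"
  define F where "F = (\<lambda>(a, c). {(b, d). b \<in> A \<and> d \<in> A \<and> a + b = c + d})"
  have F: "F (a, c) \<subseteq> A \<times> A" for a c by (auto simp: F_def)
  have finF: "finite (F x)" for x using F finite_subset[OF _ finite_cartesian_product[OF fin fin]]
    by (cases x) auto
  have finP: "finite ?P"
    by (rule finite_subset[of _ "A \<times> A"]) (auto simp: popular_pairs_def fin)
  have F_le: "card (F x) \<le> ?N" for x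
    by (rule card_inj_on_le[of fst _ A]) (auto simp: F_def inj_on_def fin case_prod_beta)
  have F_unpop: "real (card (F (a, c))) \<le> \<theta>" if "a \<in> A" "c \<in> A" "a \<noteq> c" "(a, c) \<notin> ?P" for a c
  proof -
    have finrep: "finite {(p, q). p \<in> A \<and> q \<in> A \<and> p = q + ((a - c) + (c - a))}"
      by (rule finite_subset[of _ "A \<times> A"]) (auto simp: fin)
    have "card (F (a, c)) \<le> rep_count A ((a - c) + (c - a))"
    \<comment> \<open>The sign of \<open>a - c\<close> decides which of \<open>b\<close> and
      \<open>d\<close> is larger, hence whether the pair has to be swapped to fit
      \<open>rep_count\<close>.\<close>
    proof (cases "c \<le> a")
      case True
      then have "prod.swap ` F (a, c) \<subseteq> {(p, q). p \<in> A \<and> q \<in> A \<and> p = q + ((a - c) + (c - a))}"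
        by (auto simp: F_def)
      from card_inj_on_le[OF _ this finrep] show ?thesis unfolding rep_count_def by simp
    next
      case False
      then have "F (a, c) \<subseteq> {(p, q). p \<in> A \<and> q \<in> A \<and> p = q + ((a - c) + (c - a))}"
        by (auto simp: F_def)
      from card_mono[OF finrep this] show ?thesis unfolding rep_count_def .
    qed
    moreover have "real (rep_count A ((a - c) + (c - a))) < \<theta>"
      using that by (auto simp: popular_pairs_def)
    ultimately show ?thesis by linarith
  qed
  define D where "D = (\<lambda>a. (a, a)) ` A"
  define R where "R = A \<times> A - D - ?P"
  have finR: "finite R" and finD: "finite D" using fin by (auto simp: R_def D_def)
  have AA: "A \<times> A = R \<union> (D \<union> ?P)" by (auto simp: R_def D_def popular_pairs_def)
  have cardD: "card D = ?N" by (simp add: D_def card_image inj_on_def)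
  have cardR: "card R \<le> ?N ^ 2"
    using card_mono[of "A \<times> A" R] fin by (auto simp: R_def power2_eq_square card_cartesian_product)
  have "additive_energy A \<le> card (SIGMA x:A \<times> A. F x)"
    unfolding additive_energy_def
    by (rule card_inj_on_le[of "\<lambda>(a, b, c, d). ((a, c), (b, d))"])
       (use fin finF in \<open>auto simp: F_def inj_on_def\<close>)
  also have "\<dots> = (\<Sum>x\<in>A \<times> A. card (F x))"
    using fin finF by (intro card_SigmaI) auto
  also have "\<dots> = (\<Sum>x\<in>R. card (F x)) + (\<Sum>x\<in>D \<union> ?P. card (F x))"
    unfolding AA by (rule sum.union_disjoint) (use finR finD finP in \<open>auto simp: R_def D_def\<close>)
  also have "(\<Sum>x\<in>D \<union> ?P. card (F x)) = (\<Sum>x\<in>D. card (F x)) + (\<Sum>x\<in>?P. card (F x))"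
    by (rule sum.union_disjoint) (use finD finP in \<open>auto simp: popular_pairs_def D_def\<close>)
  finally have "real (additive_energy A) \<le> real ((\<Sum>x\<in>R. card (F x)) + ((\<Sum>x\<in>D. card (F x)) + (\<Sum>x\<in>?P. card (F x))))"
    by (rule of_nat_mono)
  moreover have "(\<Sum>x\<in>R. real (card (F x))) \<le> real ?N ^ 2 * \<theta>"
  proof -
    have "(\<Sum>x\<in>R. real (card (F x))) \<le> real (card R) * \<theta>"
      by (rule sum_bounded_above) (auto simp: R_def D_def intro!: F_unpop)
    also have "\<dots> \<le> real ?N ^ 2 * \<theta>"
      using cardR \<theta> by (intro mult_right_mono) (metis of_nat_le_iff of_nat_power)
    finally show ?thesis .
  qed
  moreover have "(\<Sum>x\<in>D. real (card (F x))) \<le> real ?N ^ 2"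
    using sum_bounded_above[of D "\<lambda>x. real (card (F x))" "real ?N"] F_le
    by (simp add: cardD power2_eq_square)
  moreover have "(\<Sum>x\<in>?P. real (card (F x))) \<le> real (card ?P) * real ?N"
    by (rule sum_bounded_above) (use F_le in simp)
  ultimately show ?thesis by simp
qed

text \<open>The energy gives at least \<open>c / 4 * N ^ 2\<close> popular pairs. The averaging
  bound then makes the set where some popular difference is within 1/M of an integer have measure at
  least c/8, and shrinking the radius by \<open>\<kappa>\<close> costs the factor
  \<open>\<kappa> / 10\<close>.\<close>

lemma near_multiples_popular:
  fixes c \<kappa> :: real
  assumes fin: "finite A" and N: "N = card A" and c: "0 < c" and large: "16 / c \<le> real N"
    and E: "c * real N ^ 3 \<le> real (additive_energy A)" and \<kappa>: "0 < \<kappa>" "\<kappa> \<le> 1"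
  obtains V where "finite V" "0 \<notin> V" "\<And>v. v \<in> V \<Longrightarrow> c / 2 * real N \<le> real (rep_count A v)"
    "\<kappa> * c / 80 \<le> measure lborel (near_multiples V (16 * \<kappa> / (c * real N)))"
proof -
  define P where "P = popular_pairs A (c / 2 * real N)"
  define V where "V = (\<lambda>(a, b). (a - b) + (b - a)) ` P"
  \<comment> \<open>With this choice the diagonal loss \<open>M * N\<close> is at most half of the
    guaranteed gain \<open>c / 4 * N ^ 2\<close>; rounding down at most halves the value since
    \<open>c * N \<ge> 16\<close>.\<close>
  define M where "M = nat \<lfloor>c * real N / 8\<rfloor>"
  have PA: "P \<subseteq> A \<times> A" by (auto simp: P_def popular_pairs_def)
  have finV: "finite V" using finite_subset[OF PA] fin by (simp add: V_def)
  have V0: "0 \<notin> V" by (auto simp: V_def P_def popular_pairs_def)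
  have cN: "16 \<le> c * real N" using large c by (simp add: field_simps)
  then have Npos: "0 < real N" using c by (metis mult_zero_right not_numeral_le_zero of_nat_0_less_iff of_nat_0 gr0I)
  have M: "real M \<le> c * real N / 8" "c * real N / 16 \<le> real M"
  proof -
    have "real M = of_int \<lfloor>c * real N / 8\<rfloor>" using cN by (simp add: M_def)
    then show "real M \<le> c * real N / 8" "c * real N / 16 \<le> real M" using cN by linarith+
  qed
  then have M0: "0 < M" using cN by (cases "M = 0") auto
  have cardP: "c / 4 * real N ^ 2 \<le> real (card P)"
  proof -
    have "c * real N ^ 3 \<le> real N ^ 2 + real (card P) * real N + real N ^ 2 * (c / 2 * real N)"
      using order.trans[OF E additive_energy_le_popular_pairs[OF fin, of "c / 2 * real N"]] c
      by (simp add: N P_def)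
    then have "c / 2 * real N ^ 2 * real N \<le> (real N + real (card P)) * real N"
      by (simp add: power2_eq_square power3_eq_cube algebra_simps)
    then have 1: "c / 2 * real N ^ 2 \<le> real N + real (card P)" using Npos by simp
    have "real N * 16 \<le> real N * (c * real N)" using cN Npos by (intro mult_left_mono) auto
    then have "16 * real N \<le> c * real N ^ 2" by (simp add: power2_eq_square mult_ac)
    with 1 show ?thesis using Npos by linarith
  qed
  let ?U = "near_multiples V (1 / real M)"
  have r: "1 / real M \<le> 1" "0 < 1 / real M" using M0 by auto
  define G where "G = {0..<1} - ?U"
  have Ub: "?U \<in> sets borel" by (rule near_multiples_sets[OF V0 r(1)])
  have Gb: "G \<in> sets borel" unfolding G_def using Ub by (intro sets.Diff) auto
  have "real (card A) ^ 2 * measure lborel G \<le> real M * real (card A) + real (card A) ^ 2 - real (card P)"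
  proof (rule measure_avoiding_close_pairs_le[OF fin PA _ M0 Gb])
    show "(a, a) \<notin> P" for a by (auto simp: P_def popular_pairs_def)
    show "G \<subseteq> {0..<1}" by (auto simp: G_def)
    fix x a b and p :: int
    assume x: "x \<in> G" and ab: "(a, b) \<in> P"
    have v: "(a - b) + (b - a) \<in> V" using ab by (force simp: V_def)
    have far: "1 / real M \<le> \<bar>real ((a - b) + (b - a)) * x - of_int q\<bar>" for q :: int
      using x v by (force simp: G_def near_multiples_def not_less)
    show "1 / real M \<le> \<bar>real a * x - real b * x - of_int p\<bar>"
    proof (cases "b \<le> a")
      case True
      then show ?thesis using far[of p] by (simp add: of_nat_diff left_diff_distrib)
    next
      case False
      then have "\<bar>real ((a - b) + (b - a)) * x - of_int (-p)\<bar> = \<bar>real a * x - real b * x - of_int p\<bar>"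
        by (simp add: of_nat_diff left_diff_distrib)
      then show ?thesis using far[of "-p"] by linarith
    qed
  qed
  then have "real N ^ 2 * measure lborel G \<le> real M * real N + real N ^ 2 - c / 4 * real N ^ 2"
    using cardP by (simp add: N)
  also have "\<dots> \<le> (c * real N / 8) * real N + real N ^ 2 - c / 4 * real N ^ 2"
    using M Npos by (simp add: mult_right_mono)
  also have "\<dots> = real N ^ 2 * (1 - c / 8)" by (simp add: power2_eq_square algebra_simps)
  finally have "measure lborel G \<le> 1 - c / 8" using Npos by simp
  moreover have "1 \<le> measure lborel G + measure lborel ?U"
  proof -
    have "measure lborel {0..<1::real} \<le> measure lborel (G \<union> ?U)"
    proof (rule measure_mono_fmeasurable)
      have "bounded (G \<union> ?U)"
        by (rule bounded_subset[of "{0..1}"]) (use near_multiples_subset in \<open>auto simp: G_def\<close>)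
      then show "G \<union> ?U \<in> fmeasurable lborel"
        using Gb Ub by (intro bounded_fmeasurable_lborel) auto
    qed (auto simp: G_def)
    also have "\<dots> \<le> measure lborel G + measure lborel ?U"
      using Gb Ub by (intro measure_Un_le) auto
    finally show ?thesis by simp
  qed
  ultimately have U: "c / 8 \<le> measure lborel ?U" by linarith
  have "\<kappa> * c / 80 = \<kappa> / 10 * (c / 8)" by simp
  also have "\<dots> \<le> \<kappa> / 10 * measure lborel ?U" using U \<kappa> by (intro mult_left_mono) auto
  also have "\<dots> \<le> measure lborel (near_multiples V (\<kappa> * (1 / real M)))"
    by (rule measure_near_multiples_shrink[OF V0 finV r(2,1) \<kappa>])
  also have "\<dots> \<le> measure lborel (near_multiples V (16 * \<kappa> / (c * real N)))"
  proof (rule measure_mono_fmeasurable)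
    have "1 / real M \<le> 1 / (c * real N / 16)"
      using M(2) cN by (intro divide_left_mono) (auto intro: mult_pos_pos simp: M0)
    then have "\<kappa> * (1 / real M) \<le> \<kappa> * (1 / (c * real N / 16))" using \<kappa> by (intro mult_left_mono) auto
    then have le: "\<kappa> * (1 / real M) \<le> 16 * \<kappa> / (c * real N)" by (simp add: mult.commute)
    then show "near_multiples V (\<kappa> * (1 / real M)) \<subseteq> near_multiples V (16 * \<kappa> / (c * real N))"
      unfolding near_multiples_def by (auto intro: less_le_trans)
    have "16 * \<kappa> \<le> c * real N" using cN \<kappa> by linarith
    then have "16 * \<kappa> / (c * real N) \<le> 1" using cN by (simp add: divide_le_eq_1)
    then show "near_multiples V (16 * \<kappa> / (c * real N)) \<in> fmeasurable lborel"
      by (intro bounded_fmeasurable_lborel near_multiples_sets[OF V0]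
          bounded_subset[OF _ near_multiples_subset]) auto
    have "\<kappa> * (1 / real M) \<le> 1" using \<kappa> r by (intro mult_le_one) auto
    then show "near_multiples V (\<kappa> * (1 / real M)) \<in> sets lborel"
      using near_multiples_sets[OF V0] by simp
  qed
  finally have "\<kappa> * c / 80 \<le> measure lborel (near_multiples V (16 * \<kappa> / (c * real N)))" .
  moreover have "c / 2 * real N \<le> real (rep_count A v)" if "v \<in> V" for v
    using that by (auto simp: V_def P_def popular_pairs_def)
  ultimately show thesis using that finV V0 by blast
qed

section \<open>Triple correlations for large energy\<close>

text \<open>The circle is cut into \<open>M\<close> cells. Points whose cell contains at most two
  points number at most \<open>2 * M\<close>, that is, at most half of the lower bound for
  \<open>card G\<close>. Every other \<open>n\<close> in \<open>G\<close> has a companion in its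
  cell besides \<open>n\<close> and \<open>m n\<close>, giving a triple with one very short and one
  moderately short distance.\<close>

lemma correlation_3_ge:
  fixes y :: "nat \<Rightarrow> real" and m :: "nat \<Rightarrow> nat"
  assumes c: "0 < c" and \<delta>: "0 < \<delta>" and large: "4 / c \<le> real N"
    and y: "\<And>n. 0 \<le> y n" "\<And>n. y n < 1"
    and G: "G \<subseteq> {1..N}" "c * real N \<le> real (card G)"
    and m: "\<And>n. n \<in> G \<Longrightarrow> m n \<in> {1..N}" "\<And>n. n \<in> G \<Longrightarrow> m n \<noteq> n"
    and close: "\<And>n. n \<in> G \<Longrightarrow> real N * \<bar>signed_dist (y n - y (m n))\<bar> \<le> \<delta>"
  shows "c / 2 \<le> correlation 3 (tent_prod (\<lambda>i. if i = 2 then \<delta> else 8 / c) 3) y N"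
proof -
  \<comment> \<open>A cell has length at most \<open>8 / (c * N)\<close>, which explains the second
    tent width \<open>8 / c\<close>.\<close>
  define M where "M = nat \<lfloor>c * real N / 4\<rfloor>"
  have cN: "4 \<le> c * real N" using large c by (simp add: field_simps)
  have Npos: "0 < real N" using cN by (cases "N = 0") auto
  have M: "real M \<le> c * real N / 4" "c * real N / 8 \<le> real M"
  proof -
    have "real M = of_int \<lfloor>c * real N / 4\<rfloor>" using cN by (simp add: M_def)
    moreover have "1 \<le> \<lfloor>c * real N / 4\<rfloor>" using cN by simp
    ultimately show "real M \<le> c * real N / 4" "c * real N / 8 \<le> real M" by linarith+
  qed
  then have M0: "0 < real M" using cN by linarith
  define cell where "cell n = nat \<lfloor>real M * y n\<rfloor>" for n
  have cell_lt: "cell n < M" for n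
  proof -
    have "real M * y n < real M * 1" using y M0 by (intro mult_strict_left_mono) auto
    then show ?thesis unfolding cell_def using y M0 by (simp add: nat_less_iff floor_less_iff)
  qed
  have same_cell: "real N * \<bar>signed_dist (y n - y l)\<bar> \<le> 8 / c" if "cell n = cell l" for n l
  proof -
    have "0 \<le> real M * y n" "0 \<le> real M * y l" using y M0 by auto
    with that have "\<lfloor>real M * y n\<rfloor> = \<lfloor>real M * y l\<rfloor>"
      unfolding cell_def by (metis eq_nat_nat_iff zero_le_floor)
    then have "\<bar>real M * y n - real M * y l\<bar> \<le> 1" by linarith
    moreover have "real M * y n - real M * y l = real M * (y n - y l)" by (simp add: algebra_simps)
    ultimately have "real M * \<bar>y n - y l\<bar> \<le> 1" using M0 by (simp add: abs_mult)
    moreover have "c * real N / 8 * \<bar>y n - y l\<bar> \<le> real M * \<bar>y n - y l\<bar>"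
      using M by (intro mult_right_mono) auto
    ultimately have "real N * \<bar>y n - y l\<bar> \<le> 8 / c" using c by (simp add: field_simps)
    moreover have "\<bar>signed_dist (y n - y l)\<bar> \<le> \<bar>y n - y l\<bar>"
      using abs_signed_dist_le[of "y n - y l" 0] by simp
    ultimately show ?thesis using Npos by (meson mult_left_mono order.trans less_imp_le)
  qed
  define cls where "cls n = {l \<in> {1..N}. cell l = cell n}" for n
  define poor where "poor = {n \<in> {1..N}. card (cls n) \<le> 2}"
  have "card poor \<le> card (\<Union>q<M. {n \<in> poor. cell n = q})"
    by (rule card_mono) (use cell_lt in \<open>auto simp: poor_def\<close>)
  also have "\<dots> \<le> (\<Sum>q<M. card {n \<in> poor. cell n = q})" by (rule card_UN_le) simp
  also have "\<dots> \<le> of_nat (card {..<M}) * 2"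
  proof (rule sum_bounded_above)
    fix q
    show "card {n \<in> poor. cell n = q} \<le> 2"
    proof (cases "{n \<in> poor. cell n = q} = {}")
      case False
      then obtain n where n: "n \<in> poor" "cell n = q" by auto
      then have "{n \<in> poor. cell n = q} \<subseteq> cls n" by (auto simp: cls_def poor_def)
      then have "card {n \<in> poor. cell n = q} \<le> card (cls n)" by (rule card_mono[rotated]) (simp add: cls_def)
      then show ?thesis using n by (simp add: poor_def)
    qed (simp only: card.empty)
  qed
  finally have poor: "card poor \<le> 2 * M" by simp
  define R where "R = G - poor"
  have finG: "finite G" using G finite_subset by blast
  have "card G \<le> card R + card poor"
    unfolding R_def using card_mono[of "(G - poor) \<union> poor" G] card_Un_le[of "G - poor" poor] finG
    by (simp add: poor_def Un_Diff_cancel2)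
  then have "real (card G) \<le> real (card R) + 2 * real M" using poor by linarith
  then have R: "c / 2 * real N \<le> real (card R)" using G M by simp
  \<comment> \<open>The class of \<open>n\<close> has at least three members, so two excluded
    indices do not exhaust it. It does not matter whether \<open>m n\<close> belongs to it.\<close>
  have "\<exists>l. l \<in> cls n \<and> l \<noteq> n \<and> l \<noteq> m n" if "n \<in> R" for n
  proof (rule ccontr)
    assume "\<not> ?thesis"
    then have "cls n \<subseteq> {n, m n}" by auto
    then have "card (cls n) \<le> card {n, m n}" by (rule card_mono[rotated]) simp
    also have "\<dots> \<le> 2" by (simp add: card_insert_if)
    finally show False using that G by (auto simp: R_def poor_def)
  qed
  then obtain l where l: "\<And>n. n \<in> R \<Longrightarrow> l n \<in> cls n \<and> l n \<noteq> n \<and> l n \<noteq> m n" by metis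
  define tr where "tr n = (\<lambda>j\<in>{1..3::nat}. if j = 1 then n else if j = 2 then m n else l n)" for n
  have ivl: "{1..3::nat} = {1, 2, 3}" "{2..3::nat} = {2, 3}" by auto
  have "real (card (tr ` R)) / real N \<le> correlation 3 (tent_prod (\<lambda>i. if i = 2 then \<delta> else 8 / c) 3) y N"
  proof (rule correlation_tent_prod_ge)
    show "0 < (if i = 2 then \<delta> else 8 / c)" for i :: nat using c \<delta> by simp
    show "tr ` R \<subseteq> {i \<in> {1..3} \<rightarrow>\<^sub>E {1..N}. inj_on i {1..3}}"
    proof clarify
      fix n assume n: "n \<in> R"
      then have nG: "n \<in> G" by (simp add: R_def)
      have "tr n \<in> {1..3} \<rightarrow>\<^sub>E {1..N}"
        using m(1)[OF nG] l[OF n] G nG by (auto simp: tr_def cls_def)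
      moreover have "inj_on (tr n) {1..3}"
        unfolding ivl using m(2)[OF nG] l[OF n] by (auto simp: tr_def inj_on_def)
      ultimately show "tr n \<in> {1..3} \<rightarrow>\<^sub>E {1..N} \<and> inj_on (tr n) {1..3}" by blast
    qed
    show "real N * \<bar>signed_dist (y (i 1) - y (i j))\<bar> \<le> (if j = 2 then \<delta> else 8 / c)"
      if i: "i \<in> tr ` R" and j: "j \<in> {2..3}" for i j
    proof -
      obtain n where n: "n \<in> R" "i = tr n" using i by blast
      have "real N * \<bar>signed_dist (y n - y (l n))\<bar> \<le> 8 / c"
        by (rule same_cell) (use l[OF n(1)] in \<open>simp add: cls_def\<close>)
      then show ?thesis using j n close[of n] unfolding ivl by (auto simp: tr_def R_def)
    qed
  qed
  moreover have "card (tr ` R) = card R"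
  proof (rule card_image, rule inj_onI)
    fix n n' assume "tr n = tr n'"
    then have "tr n 1 = tr n' 1" by simp
    then show "n = n'" by (simp add: tr_def)
  qed
  moreover have "c / 2 \<le> real (card R) / real N" using R Npos by (simp add: field_simps)
  ultimately show ?thesis by (metis order.trans)
qed

text \<open>All representations of one difference \<open>v\<close> have the same distance modulo 1,
  so a single \<open>v\<close> with \<open>v x\<close> near an integer makes all of them close at
  once. \<open>G\<close> collects the indices of the smaller terms, and \<open>m\<close> gives the
  indices of the larger ones.\<close>

lemma correlation_3_near_multiples:
  fixes a :: "nat \<Rightarrow> nat"
  assumes inj: "inj_on a {1..N}" and c: "0 < c" "4 / c \<le> real N" and \<delta>: "0 < \<delta>"
    and V: "0 \<notin> V" "\<And>v. v \<in> V \<Longrightarrow> c * real N \<le> real (rep_count (a ` {1..N}) v)"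
    and x: "x \<in> near_multiples V (\<delta> / real N)"
  shows "c / 2 \<le> correlation 3 (tent_prod (\<lambda>i. if i = 2 then \<delta> else 8 / c) 3) (\<lambda>n. frac (real (a n) * x)) N"
proof -
  obtain v p where v: "v \<in> V" and p: "\<bar>real v * x - of_int (p::int)\<bar> < \<delta> / real N"
    using x by (auto simp: near_multiples_def)
  have v0: "v \<noteq> 0" using v V(1) by metis
  have Npos: "0 < real N" using c by (metis divide_pos_pos less_le_trans zero_less_numeral)
  define G where "G = {n \<in> {1..N}. \<exists>l\<in>{1..N}. a l = a n + v}"
  then have "\<forall>n\<in>G. \<exists>l. l \<in> {1..N} \<and> a l = a n + v" by auto
  then obtain m where m: "\<And>n. n \<in> G \<Longrightarrow> m n \<in> {1..N} \<and> a (m n) = a n + v" by metis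
  have "rep_count (a ` {1..N}) v \<le> card ((\<lambda>n. (a n + v, a n)) ` G)"
    unfolding rep_count_def by (rule card_mono) (auto simp: G_def)
  also have "\<dots> \<le> card G" by (rule card_image_le) (simp add: G_def)
  finally have G: "c * real N \<le> real (card G)" using V(2)[OF v] by linarith
  show ?thesis
  proof (rule correlation_3_ge[OF c(1) \<delta> c(2) _ _ _ G])
    show "G \<subseteq> {1..N}" by (auto simp: G_def)
    show "m n \<in> {1..N}" if "n \<in> G" for n using m[OF that] by simp
    show "m n \<noteq> n" if "n \<in> G" for n using m[OF that] v0 by auto
    show "real N * \<bar>signed_dist (frac (real (a n) * x) - frac (real (a (m n)) * x))\<bar> \<le> \<delta>"
      if n: "n \<in> G" for n
    proof -
      have "\<bar>signed_dist (frac (real (a n) * x) - frac (real (a (m n)) * x))\<bar>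
          \<le> \<bar>real (a n) * x - real (a (m n)) * x - of_int (-p)\<bar>"
        by (rule abs_signed_dist_frac_diff_le)
      also have "\<dots> = \<bar>real v * x - of_int p\<bar>" using m[OF n] by (simp add: algebra_simps abs_minus_commute)
      also have "\<dots> \<le> \<delta> / real N" using p by simp
      finally show ?thesis using Npos by (simp add: pos_le_divide_eq mult.commute)
    qed
  qed (simp_all add: frac_lt_1)
qed

text \<open>The tail unions decrease inside a set of finite measure and each contains some
  \<open>U N\<close>, so continuity from above preserves the lower bound
  \<open>\<tau>\<close>.\<close>

lemma emeasure_limsup_ge:
  fixes U :: "nat \<Rightarrow> real set"
  assumes sets: "\<And>N. N \<in> K \<Longrightarrow> U N \<in> sets borel" and sub: "\<And>N. U N \<subseteq> {0..1}"
    and K: "infinite K" and \<tau>: "\<And>N. N \<in> K \<Longrightarrow> \<tau> \<le> measure lborel (U N)"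
  shows "(\<Inter>m. \<Union>N\<in>K \<inter> {m..}. U N) \<in> sets borel"
    and "ennreal \<tau> \<le> emeasure lborel (\<Inter>m. \<Union>N\<in>K \<inter> {m..}. U N)"
proof -
  define W where "W m = (\<Union>N\<in>K \<inter> {m..}. U N)" for m
  have Wb: "W m \<in> sets borel" for m unfolding W_def using sets by (intro sets.countable_UN') auto
  have Wsub: "W m \<subseteq> {0..1}" for m using sub by (auto simp: W_def)
  have bdd: "bounded A" if "A \<subseteq> {0..1}" for A :: "real set"
    using that bounded_subset bounded_closed_interval by blast
  show "(\<Inter>m. \<Union>N\<in>K \<inter> {m..}. U N) \<in> sets borel"
    using Wb unfolding W_def[symmetric] by (intro sets.countable_INT) auto
  have "(\<lambda>m. emeasure lborel (W m)) \<longlonglongrightarrow> emeasure lborel (\<Inter>m. W m)"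
  proof (rule Lim_emeasure_decseq)
    show "decseq W" by (auto simp: W_def decseq_def)
    show "emeasure lborel (W m) \<noteq> \<infinity>" for m
      using emeasure_bounded_finite[OF bdd[OF Wsub]] by (simp add: less_top)
  qed (use Wb in auto)
  moreover have "ennreal \<tau> \<le> emeasure lborel (W m)" for m
  proof -
    obtain N where N: "N \<in> K" "m \<le> N" using K by (meson infinite_nat_iff_unbounded_le)
    have fin: "emeasure lborel (U N) = ennreal (measure lborel (U N))"
      using emeasure_bounded_finite[OF bdd[OF sub]] by (simp add: emeasure_eq_ennreal_measure less_top)
    have "ennreal \<tau> \<le> emeasure lborel (U N)" unfolding fin using \<tau>[OF N(1)] by (rule ennreal_leI)
    also have "\<dots> \<le> emeasure lborel (W m)"
      using N Wb by (intro emeasure_mono) (auto simp: W_def)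
    finally show ?thesis .
  qed
  ultimately show "ennreal \<tau> \<le> emeasure lborel (\<Inter>m. \<Union>N\<in>K \<inter> {m..}. U N)"
    unfolding W_def[symmetric] by (intro LIMSEQ_le_const) auto
qed

lemma limsup_pos_imp_infinite:
  fixes u :: "nat \<Rightarrow> real"
  assumes "0 < limsup (\<lambda>N. ereal (u N))"
  obtains c where "0 < c" "c \<le> 1" "infinite {N. c \<le> u N}"
proof -
  obtain c0 where c0: "0 < ereal c0" "ereal c0 < limsup (\<lambda>N. ereal (u N))"
    using ereal_dense2[OF assms] by auto
  define c where "c = min c0 1"
  have "infinite {N. c \<le> u N}"
  proof
    assume "finite {N. c \<le> u N}"
    then have "eventually (\<lambda>N. \<not> c \<le> u N) sequentially"
      by (simp add: eventually_cofinite cofinite_eq_sequentially[symmetric])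
    then have "limsup (\<lambda>N. ereal (u N)) \<le> ereal c"
      by (intro Limsup_bounded) (auto elim!: eventually_mono)
    also have "\<dots> \<le> ereal c0" by (simp add: c_def)
    finally show False using c0 by simp
  qed
  then show thesis using that[of c] c0 by (simp add: c_def)
qed

lemma not_poissonian_3_of_large_energy:
  fixes a :: "nat \<Rightarrow> nat"
  assumes mono: "strict_mono_on {1..} a"
    and E: "limsup (\<lambda>N. ereal (real (additive_energy (a ` {1..N})) / real N ^ 3)) > 0"
  shows "\<exists>X \<in> sets lebesgue. X \<subseteq> {0..1} \<and> emeasure lebesgue X > 0 \<and>
         (\<forall>x\<in>X. \<not> poissonian_correlations 3 (\<lambda>n. frac (real (a n) * x)))"
proof -
  obtain c where c: "0 < c" "c \<le> 1"
    and inf: "infinite {N. c \<le> real (additive_energy (a ` {1..N})) / real N ^ 3}"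
    using limsup_pos_imp_infinite[OF E] by blast
  \<comment> \<open>With widths \<open>\<delta> = 16 * \<kappa> / c\<close> and
    \<open>16 / c\<close> the integral is at most \<open>16384 * \<kappa> / c^2\<close>. The choice
    of \<open>\<kappa>\<close> makes this less than \<open>c / 4\<close>, the lower bound for the
    correlations.\<close>
  define \<kappa> where "\<kappa> = c ^ 3 / 100000"
  have \<kappa>: "0 < \<kappa>" "\<kappa> \<le> 1" using c power_le_one[of c 3] by (auto simp: \<kappa>_def)
  define \<delta> where "\<delta> = 16 * \<kappa> / c"
  have \<delta>: "0 < \<delta>" using \<kappa> c by (simp add: \<delta>_def)
  have inj: "inj_on a {1..N}" for N
    using strict_mono_on_imp_inj_on[OF mono] by (rule inj_on_subset) auto
  define K where "K = {N. c \<le> real (additive_energy (a ` {1..N})) / real N ^ 3} \<inter> {nat \<lceil>16 / c\<rceil>..}"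
  have "infinite K"
  proof
    assume "finite K"
    moreover have "{N. c \<le> real (additive_energy (a ` {1..N})) / real N ^ 3} \<subseteq> K \<union> {..<nat \<lceil>16 / c\<rceil>}"
      by (auto simp: K_def not_less nat_ceiling_le_eq)
    ultimately show False using inf finite_subset by (metis finite_UnI finite_lessThan)
  qed
  have largeK: "16 / c \<le> real N" if "N \<in> K" for N using that by (simp add: K_def nat_ceiling_le_eq)
  have "\<exists>V. finite V \<and> 0 \<notin> V \<and> (\<forall>v\<in>V. c / 2 * real N \<le> real (rep_count (a ` {1..N}) v)) \<and>
      \<kappa> * c / 80 \<le> measure lborel (near_multiples V (\<delta> / real N))" if N: "N \<in> K" for N
  proof -
    have Npos: "0 < real N" using largeK[OF N] c by (metis divide_pos_pos less_le_trans zero_less_numeral)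
    have "c * real N ^ 3 \<le> real (additive_energy (a ` {1..N}))"
      using N Npos by (simp add: K_def pos_le_divide_eq)
    moreover have "N = card (a ` {1..N})" using card_image[OF inj[of N]] by simp
    ultimately obtain V where "finite V" "0 \<notin> V"
      "\<And>v. v \<in> V \<Longrightarrow> c / 2 * real N \<le> real (rep_count (a ` {1..N}) v)"
      "\<kappa> * c / 80 \<le> measure lborel (near_multiples V (16 * \<kappa> / (c * real N)))"
      using near_multiples_popular[of "a ` {1..N}" N c \<kappa>] c largeK[OF N] \<kappa> by blast
    then show ?thesis by (intro exI[of _ V]) (simp add: \<delta>_def)
  qed
  then obtain V where V: "\<And>N. N \<in> K \<Longrightarrow> 0 \<notin> V N"
    "\<And>N v. N \<in> K \<Longrightarrow> v \<in> V N \<Longrightarrow> c / 2 * real N \<le> real (rep_count (a ` {1..N}) v)"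
    "\<And>N. N \<in> K \<Longrightarrow> \<kappa> * c / 80 \<le> measure lborel (near_multiples (V N) (\<delta> / real N))"
    by metis
  let ?U = "\<lambda>N. near_multiples (V N) (\<delta> / real N)"
  \<comment> \<open>The limit superior of the sets: each of its points lies in \<open>?U N\<close>
    for infinitely many \<open>N\<close> in \<open>K\<close>.\<close>
  define X where "X = (\<Inter>m. \<Union>N\<in>K \<inter> {m..}. ?U N)"
  have \<delta>N: "\<delta> / real N \<le> 1" if N: "N \<in> K" for N
  proof -
    have "\<delta> \<le> 16 / c" using \<kappa> c by (simp add: \<delta>_def divide_right_mono)
    then have "\<delta> \<le> real N" using largeK[OF N] by linarith
    then show ?thesis using \<delta> by (simp add: divide_le_eq_1)
  qed
  have Xb: "X \<in> sets borel" and Xm: "ennreal (\<kappa> * c / 80) \<le> emeasure lborel X"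
    unfolding X_def using emeasure_limsup_ge[of K ?U "\<kappa> * c / 80"] V near_multiples_sets \<delta>N
      near_multiples_subset \<open>infinite K\<close> by blast+
  have "emeasure lebesgue X = emeasure lborel X" using Xb by simp
  moreover have "0 < ennreal (\<kappa> * c / 80)" using \<kappa> c by simp
  ultimately have "0 < emeasure lebesgue X" using Xm by (metis less_le_trans)
  moreover have "X \<in> sets lebesgue" using Xb by simp
  moreover have "X \<subseteq> {0..1}" using near_multiples_subset by (fastforce simp: X_def)
  moreover have "\<not> poissonian_correlations 3 (\<lambda>n. frac (real (a n) * x))" if x: "x \<in> X" for x
  proof
    assume P: "poissonian_correlations 3 (\<lambda>n. frac (real (a n) * x))"
    let ?w = "\<lambda>i::nat. if i = 2 then \<delta> else 8 / (c / 2)"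
    let ?f = "tent_prod ?w 3"
    have w: "\<And>i. i \<in> {2..3} \<Longrightarrow> 0 < ?w i" using \<delta> c by simp
    have "integral\<^sup>L (PiM {2..3} (\<lambda>_. lborel)) ?f \<le> (\<Prod>i\<in>{2..3}. 8 * ?w i)"
      by (rule integral_tent_prod_le[OF w])
    also have "\<dots> = 16384 * \<kappa> / c\<^sup>2"
    proof -
      have "{2..3::nat} = {2, 3}" by auto
      then show ?thesis using c by (simp add: \<delta>_def power2_eq_square)
    qed
    also have "\<dots> < c / 4" using c by (simp add: \<kappa>_def power2_eq_square power3_eq_cube field_simps)
    finally have "integral\<^sup>L (PiM {2..3} (\<lambda>_. lborel)) ?f < c / 4" .
    moreover have "(\<lambda>N. correlation 3 ?f (\<lambda>n. frac (real (a n) * x)) N)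
        \<longlonglongrightarrow> integral\<^sup>L (PiM {2..3} (\<lambda>_. lborel)) ?f"
      using P nonneg_Cc_tent_prod[OF w] by (simp add: poissonian_correlations_def)
    ultimately have "eventually (\<lambda>N. correlation 3 ?f (\<lambda>n. frac (real (a n) * x)) N < c / 4) sequentially"
      by (rule order_tendstoD(2)[rotated])
    then obtain m where m: "\<And>N. m \<le> N \<Longrightarrow> correlation 3 ?f (\<lambda>n. frac (real (a n) * x)) N < c / 4"
      by (auto simp: eventually_sequentially)
    obtain N where N: "N \<in> K" "m \<le> N" "x \<in> ?U N" using x by (fastforce simp: X_def)
    \<comment> \<open>Popular differences have \<open>c / 2 * N\<close> representations, so the
      correlation bound is applied with \<open>c / 2\<close> in place of \<open>c\<close>.\<close>
    have "4 / (c / 2) \<le> real N" using largeK[OF N(1)] c by (simp add: field_simps)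
    then have "c / 2 / 2 \<le> correlation 3 ?f (\<lambda>n. frac (real (a n) * x)) N"
      using V(1,2)[OF N(1)] N(3) c \<delta> by (intro correlation_3_near_multiples inj) auto
    with m[OF N(2)] show False by simp
  qed
  ultimately show ?thesis by blast
qed

section \<open>Energy of sparse sequences and independent digits\<close>

text \<open>If no two indices on opposite sides of an equation are within \<open>W\<close>, the
  largest term exceeds twice each term on the other side, hence their sum. So one of four opposite
  pairs of indices is close. There are at most \<open>2 * W * N ^ 2\<close> choices for this pair
  and a third index, and the equation determines the fourth term.\<close>

lemma additive_energy_le_of_sparse:
  fixes a :: "nat \<Rightarrow> nat"
  assumes sparse: "\<And>m n. 1 \<le> n \<Longrightarrow> n + W \<le> m \<Longrightarrow> m \<le> N \<Longrightarrow> 2 * a n < a m"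
  shows "additive_energy (a ` {1..N}) \<le> 8 * W * N ^ 2"
proof -
  let ?I = "{1..N}"
  define T where "T = {(i, j, k). i \<in> ?I \<and> j \<in> ?I \<and> k \<in> ?I \<and> i < k + W \<and> k < i + W}"
  \<comment> \<open>The four maps rebuild the quadruple according to which opposite pair is close;
    on solutions of the equation the truncated subtraction is exact.\<close>
  define f1 where "f1 = (\<lambda>(i, j, k). (a i, a j, a k, a i + a j - a k))"
  define f2 where "f2 = (\<lambda>(i, j, k). (a i, a j, a i + a j - a k, a k))"
  define f3 where "f3 = (\<lambda>(i, j, k). (a j, a i, a k, a i + a j - a k))"
  define f4 where "f4 = (\<lambda>(i, j, k). (a j, a i, a i + a j - a k, a k))"
  \<comment> \<open>The difference \<open>k - i\<close> is encoded as \<open>s = k + W - i\<close>,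
    which is a natural number below \<open>2 * W\<close>.\<close>
  have T: "T \<subseteq> (\<lambda>(i, j, s). (i, j, i + s - W)) ` (?I \<times> ?I \<times> {..<2 * W})"
  proof
    fix z assume "z \<in> T"
    then obtain i j k where z: "z = (i, j, k)" "i \<in> ?I" "j \<in> ?I" "i < k + W" "k < i + W"
      by (auto simp: T_def)
    then have "z = (\<lambda>(i, j, s). (i, j, i + s - W)) (i, j, k + W - i)"
      "(i, j, k + W - i) \<in> ?I \<times> ?I \<times> {..<2 * W}" by auto
    then show "z \<in> (\<lambda>(i, j, s). (i, j, i + s - W)) ` (?I \<times> ?I \<times> {..<2 * W})" by (rule image_eqI)
  qed
  then have finT: "finite T" by (rule finite_subset) simp
  have "card T \<le> card (?I \<times> ?I \<times> {..<2 * W})"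
    by (rule surj_card_le[OF _ T]) simp
  then have cardT: "card T \<le> 2 * W * N ^ 2"
    by (simp add: card_cartesian_product power2_eq_square mult_ac)
  have sub: "{(p, q, r, s). p \<in> a ` ?I \<and> q \<in> a ` ?I \<and> r \<in> a ` ?I \<and> s \<in> a ` ?I \<and> p + q = r + s}
      \<subseteq> (f1 ` T \<union> f2 ` T) \<union> (f3 ` T \<union> f4 ` T)"
  proof clarify
    fix i j k l
    assume I: "i \<in> ?I" "j \<in> ?I" "k \<in> ?I" "l \<in> ?I" and eq: "a i + a j = a k + a l"
      and n4: "(a i, a j, a k, a l) \<notin> f4 ` T" and n3: "(a i, a j, a k, a l) \<notin> f3 ` T"
      and n2: "(a i, a j, a k, a l) \<notin> f2 ` T"
    have ratio: "2 * a u < a v \<or> 2 * a v < a u" if "u \<in> ?I" "v \<in> ?I" "\<not> (u < v + W \<and> v < u + W)" for u v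
      using sparse[of u v] sparse[of v u] that by auto
    show "(a i, a j, a k, a l) \<in> f1 ` T"
    proof (rule ccontr)
      assume n1: "(a i, a j, a k, a l) \<notin> f1 ` T"
      have "\<not> (i < k + W \<and> k < i + W)"
      proof
        assume "i < k + W \<and> k < i + W"
        then have "(i, j, k) \<in> T" using I by (simp add: T_def)
        moreover have "(a i, a j, a k, a l) = f1 (i, j, k)" using eq by (simp add: f1_def)
        ultimately show False using n1 by blast
      qed
      then have 1: "2 * a i < a k \<or> 2 * a k < a i" using ratio I by blast
      have "\<not> (i < l + W \<and> l < i + W)"
      proof
        assume "i < l + W \<and> l < i + W"
        then have "(i, j, l) \<in> T" using I by (simp add: T_def)
        moreover have "(a i, a j, a k, a l) = f2 (i, j, l)" using eq by (simp add: f2_def)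
        ultimately show False using n2 by blast
      qed
      then have 2: "2 * a i < a l \<or> 2 * a l < a i" using ratio I by blast
      have "\<not> (j < k + W \<and> k < j + W)"
      proof
        assume "j < k + W \<and> k < j + W"
        then have "(j, i, k) \<in> T" using I by (simp add: T_def)
        moreover have "(a i, a j, a k, a l) = f3 (j, i, k)" using eq by (simp add: f3_def)
        ultimately show False using n3 by blast
      qed
      then have 3: "2 * a j < a k \<or> 2 * a k < a j" using ratio I by blast
      have "\<not> (j < l + W \<and> l < j + W)"
      proof
        assume "j < l + W \<and> l < j + W"
        then have "(j, i, l) \<in> T" using I by (simp add: T_def)
        moreover have "(a i, a j, a k, a l) = f4 (j, i, l)" using eq by (simp add: f4_def)
        ultimately show False using n4 by blast
      qed
      then have 4: "2 * a j < a l \<or> 2 * a l < a j" using ratio I by blast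
      show False using 1 2 3 4 eq by (elim disjE) linarith+
    qed
  qed
  have "additive_energy (a ` ?I) \<le> card ((f1 ` T \<union> f2 ` T) \<union> (f3 ` T \<union> f4 ` T))"
    unfolding additive_energy_def by (rule card_mono[OF _ sub]) (simp add: finT)
  also have "\<dots> \<le> (card (f1 ` T) + card (f2 ` T)) + (card (f3 ` T) + card (f4 ` T))"
    by (intro order.trans[OF card_Un_le] add_mono card_Un_le)
  also have "\<dots> \<le> (card T + card T) + (card T + card T)"
    by (intro add_mono card_image_le finT)
  finally show ?thesis using cardT by simp
qed

section \<open>Digits in a mixed base and the divergence half of Borel--Cantelli\<close>

lemma emeasure_cells_le:
  assumes "finite S" "0 < D"
  shows "emeasure lborel (\<Union>r\<in>S. {real r / real D..<(real r + 1) / real D}) \<le> ennreal (real (card S) / real D)"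
proof -
  have "emeasure lborel {real r / real D..<(real r + 1) / real D} = ennreal (1 / real D)" for r :: nat
    using assms by (subst emeasure_lborel_Ico) (auto simp: divide_right_mono diff_divide_distrib[symmetric])
  then have "(\<Sum>r\<in>S. emeasure lborel {real r / real D..<(real r + 1) / real D}) = ennreal (real (card S) / real D)"
    by (simp add: ennreal_of_nat_eq_real_of_nat ennreal_mult[symmetric])
  moreover have "emeasure lborel (\<Union>r\<in>S. {real r / real D..<(real r + 1) / real D})
      \<le> (\<Sum>r\<in>S. emeasure lborel {real r / real D..<(real r + 1) / real D})"
    by (rule emeasure_subadditive_finite) (use assms in auto)
  ultimately show ?thesis by simp
qed

lemma mem_cell:
  fixes x :: real
  assumes "0 < D" "0 \<le> x"
  shows "x \<in> {real (nat \<lfloor>real D * x\<rfloor>) / real D..<(real (nat \<lfloor>real D * x\<rfloor>) + 1) / real D}"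
proof -
  have "real (nat \<lfloor>real D * x\<rfloor>) = of_int \<lfloor>real D * x\<rfloor>" using assms by simp
  then show ?thesis using assms floor_correct[of "real D * x"] by (simp add: field_simps)
qed

text \<open>Since \<open>D (Suc n) = H n * D n\<close>, the floor of \<open>D (Suc n) * x\<close> is
  \<open>H n\<close> times the floor of \<open>D n * x\<close> plus the next digit. Hence each
  surviving cell of level \<open>n\<close> has \<open>H n - card (A n)\<close> surviving subcells:
  counting replaces the independence of the digits.\<close>

lemma digit_avoiding_cover:
  fixes H D :: "nat \<Rightarrow> nat" and A :: "nat \<Rightarrow> nat set"
  assumes D: "\<And>j. D (Suc j) = H j * D j" "D 0 = 1" and H: "\<And>j. 0 < H j" and A: "\<And>j. A j \<subseteq> {..<H j}"
    and "m \<le> n"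
  shows "\<exists>S. finite S \<and> real (card S) \<le> real (D n) * (\<Prod>i\<in>{m..<n}. 1 - real (card (A i)) / real (H i)) \<and>
    (\<forall>x\<in>{0..<1}. (\<forall>i\<in>{m..<n}. nat \<lfloor>real (H i) * frac (real (D i) * x)\<rfloor> \<notin> A i) \<longrightarrow> nat \<lfloor>real (D n) * x\<rfloor> \<in> S)"
  using \<open>m \<le> n\<close>
proof (induction n rule: dec_induct)
  case base
  have "nat \<lfloor>real (D m) * x\<rfloor> < D m" if "0 \<le> x" "x < 1" for x :: real
  proof -
    have "0 < D m" using D H by (induction m) auto
    then have "real (D m) * x < real (D m)" using that by simp
    then show ?thesis using that \<open>0 < D m\<close> by (simp add: nat_less_iff floor_less_iff)
  qed
  then show ?case by (intro exI[of _ "{..<D m}"]) auto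
next
  case (step n)
  then obtain S where S: "finite S"
    "real (card S) \<le> real (D n) * (\<Prod>i\<in>{m..<n}. 1 - real (card (A i)) / real (H i))"
    "\<And>x. x \<in> {0..<1} \<Longrightarrow> (\<forall>i\<in>{m..<n}. nat \<lfloor>real (H i) * frac (real (D i) * x)\<rfloor> \<notin> A i) \<Longrightarrow> nat \<lfloor>real (D n) * x\<rfloor> \<in> S"
    by auto
  define S' where "S' = (\<lambda>(q, b). q * H n + b) ` (S \<times> ({..<H n} - A n))"
  have "card S' \<le> card (S \<times> ({..<H n} - A n))" unfolding S'_def by (rule card_image_le) (simp add: S)
  also have "\<dots> = card S * (H n - card (A n))"
    using A[of n] by (simp add: card_cartesian_product card_Diff_subset finite_subset[OF A])
  finally have "real (card S') \<le> real (card S) * real (H n - card (A n))"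
    by (metis of_nat_le_iff of_nat_mult)
  also have "real (H n - card (A n)) = real (H n) * (1 - real (card (A n)) / real (H n))"
    using card_mono[OF _ A[of n]] H[of n] by (simp add: of_nat_diff field_simps)
  also have "real (card S) * (real (H n) * (1 - real (card (A n)) / real (H n)))
      \<le> real (D n) * (\<Prod>i\<in>{m..<n}. 1 - real (card (A i)) / real (H i)) * (real (H n) * (1 - real (card (A n)) / real (H n)))"
    using S(2) card_mono[OF _ A[of n]] H[of n] by (intro mult_right_mono) auto
  also have "\<dots> = real (D (Suc n)) * (\<Prod>i\<in>{m..<Suc n}. 1 - real (card (A i)) / real (H i))"
    using step(1) D by (simp add: prod.atLeastLessThan_Suc mult_ac)
  finally have card: "real (card S') \<le> real (D (Suc n)) * (\<Prod>i\<in>{m..<Suc n}. 1 - real (card (A i)) / real (H i))" .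
  have "nat \<lfloor>real (D (Suc n)) * x\<rfloor> \<in> S'"
    if x: "x \<in> {0..<1}" and avoid: "\<forall>i\<in>{m..<Suc n}. nat \<lfloor>real (H i) * frac (real (D i) * x)\<rfloor> \<notin> A i" for x
  proof -
    define b where "b = \<lfloor>real (H n) * frac (real (D n) * x)\<rfloor>"
    have "real (D (Suc n)) * x = real_of_int (int (H n) * \<lfloor>real (D n) * x\<rfloor>) + real (H n) * frac (real (D n) * x)"
      by (simp add: D frac_def algebra_simps)
    then have fl: "\<lfloor>real (D (Suc n)) * x\<rfloor> = int (H n) * \<lfloor>real (D n) * x\<rfloor> + b"
      unfolding b_def by (metis add.commute floor_add_int)
    have fr: "0 \<le> frac (real (D n) * x)" "frac (real (D n) * x) < 1" by (simp_all add: frac_lt_1)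
    then have "real (H n) * frac (real (D n) * x) < real (H n)" using H[of n] by simp
    then have b: "0 \<le> b" "b < int (H n)" using fr by (simp_all add: b_def floor_less_iff)
    have "0 \<le> \<lfloor>real (D n) * x\<rfloor>" using x by simp
    then have "nat \<lfloor>real (D (Suc n)) * x\<rfloor> = nat \<lfloor>real (D n) * x\<rfloor> * H n + nat b"
      unfolding fl using b by (simp add: nat_add_distrib nat_mult_distrib mult.commute)
    moreover have "nat b \<in> {..<H n} - A n" using b avoid step(1) by (auto simp: b_def nat_less_iff)
    moreover have "nat \<lfloor>real (D n) * x\<rfloor> \<in> S" using S(3)[OF x] avoid by simp
    ultimately show ?thesis unfolding S'_def by force
  qed
  with card show ?case using S(1) by (intro exI[of _ S']) (auto simp: S'_def)
qed

text \<open>The points avoiding all \<open>A j\<close> with \<open>j \<ge> m\<close> are covered,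
  for every \<open>n \<ge> m\<close>, by cells of total measure at most the partial product, which
  tends to 0. A union over the countably many \<open>m\<close> finishes the argument.\<close>

lemma AE_digit_infinitely_often:
  fixes H D :: "nat \<Rightarrow> nat" and A :: "nat \<Rightarrow> nat set"
  assumes D: "\<And>j. D (Suc j) = H j * D j" "D 0 = 1" and H: "\<And>j. 0 < H j" and A: "\<And>j. A j \<subseteq> {..<H j}"
    and lim: "\<And>m. (\<lambda>n. \<Prod>i\<in>{m..<n}. 1 - real (card (A i)) / real (H i)) \<longlonglongrightarrow> 0"
  shows "AE x in lborel. x \<in> {0..<1} \<longrightarrow> infinite {j. nat \<lfloor>real (H j) * frac (real (D j) * x)\<rfloor> \<in> A j}"
proof -
  let ?p = "\<lambda>m n. \<Prod>i\<in>{m..<n}. 1 - real (card (A i)) / real (H i)"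
  have Dpos: "0 < D n" for n using D H by (induction n) auto
  let ?dig = "\<lambda>j x. nat \<lfloor>real (H j) * frac (real (D j) * x)\<rfloor>"
  have "\<exists>Z\<in>null_sets lborel. \<forall>x\<in>{0..<1}. (\<forall>j\<ge>m. ?dig j x \<notin> A j) \<longrightarrow> x \<in> Z" for m
  proof -
    let ?Q = "\<lambda>n S. finite S \<and> real (card S) \<le> real (D n) * ?p m n \<and>
      (\<forall>x\<in>{0..<1}. (\<forall>i\<in>{m..<n}. ?dig i x \<notin> A i) \<longrightarrow> nat \<lfloor>real (D n) * x\<rfloor> \<in> S)"
    have "\<forall>n. \<exists>S. m \<le> n \<longrightarrow> ?Q n S" using digit_avoiding_cover[OF D H A] by blast
    from choice[OF this] obtain S where S: "\<And>n. m \<le> n \<Longrightarrow> ?Q n (S n)" by blast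
    define C where "C n = (\<Union>r\<in>S n. {real r / real (D n)..<(real r + 1) / real (D n)})" for n
    have Cb: "C n \<in> sets borel" if "m \<le> n" for n unfolding C_def using S[OF that] by auto
    have Ce: "emeasure lborel (C n) \<le> ennreal (?p m n)" if "m \<le> n" for n
    proof -
      have "emeasure lborel (C n) \<le> ennreal (real (card (S n)) / real (D n))"
        unfolding C_def by (rule emeasure_cells_le) (use S[OF that] Dpos in auto)
      also have "\<dots> \<le> ennreal (?p m n)"
        using S[OF that] Dpos[of n] by (intro ennreal_leI) (simp add: divide_le_eq mult.commute)
      finally show ?thesis .
    qed
    let ?Z = "\<Inter>n\<in>{m..}. C n"
    have "?Z \<in> null_sets lborel"
    proof (rule null_setsI)
      have "(\<lambda>n. ennreal (?p m n)) \<longlonglongrightarrow> ennreal 0" by (intro tendsto_ennrealI lim)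
      moreover have "\<forall>\<^sub>F n in sequentially. emeasure lborel ?Z \<le> ennreal (?p m n)"
        using eventually_ge_at_top[of m]
      proof eventually_elim
        case (elim n)
        then have "emeasure lborel ?Z \<le> emeasure lborel (C n)"
          using Cb by (intro emeasure_mono) auto
        also have "\<dots> \<le> ennreal (?p m n)" by (rule Ce[OF elim])
        finally show ?case .
      qed
      ultimately have "emeasure lborel ?Z \<le> ennreal 0"
        by (rule tendsto_lowerbound) simp
      then show "emeasure lborel ?Z = 0" by simp
      show "?Z \<in> sets lborel" using Cb by (intro sets.countable_INT'') auto
    qed
    moreover have "x \<in> ?Z" if x: "x \<in> {0..<1}" and avoid: "\<forall>j\<ge>m. ?dig j x \<notin> A j" for x
    proof
      fix n assume "n \<in> {m..}"
      then have "nat \<lfloor>real (D n) * x\<rfloor> \<in> S n" using S[of n] x avoid by simp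
      moreover have "0 \<le> x" using x by simp
      ultimately show "x \<in> C n" unfolding C_def using mem_cell[OF Dpos[of n]] by blast
    qed
    ultimately show ?thesis by blast
  qed
  then have "\<forall>m. \<exists>Z. Z \<in> null_sets lborel \<and> (\<forall>x\<in>{0..<1}. (\<forall>j\<ge>m. ?dig j x \<notin> A j) \<longrightarrow> x \<in> Z)"
    by blast
  from choice[OF this] obtain Z where Z: "\<And>m. Z m \<in> null_sets lborel"
    "\<And>m x. x \<in> {0..<1} \<Longrightarrow> (\<forall>j\<ge>m. ?dig j x \<notin> A j) \<Longrightarrow> x \<in> Z m" by blast
  have "AE x in lborel. \<forall>m. x \<notin> Z m"
    unfolding AE_all_countable by (intro allI AE_not_in Z(1))
  then show ?thesis
  proof eventually_elim
    case (elim x)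
    show ?case
    proof
      assume x: "x \<in> {0..<1}"
      show "infinite {j. ?dig j x \<in> A j}"
      proof
        assume "finite {j. ?dig j x \<in> A j}"
        then obtain m where "\<forall>j\<in>{j. ?dig j x \<in> A j}. j < m"
          using finite_nat_set_iff_bounded by blast
        then have "\<forall>j\<ge>m. ?dig j x \<notin> A j" by (auto simp: not_le[symmetric])
        then show False using Z(2)[OF x] elim by blast
      qed
    qed
  qed
qed

text \<open>Each factor is at most \<open>exp (- c / (n + d))\<close>, hence at most the power
  \<open>c\<close> of \<open>(n + d) / (n + 1 + d)\<close>. These powers telescope to a negative
  power of \<open>n + d\<close>.\<close>

lemma prod_one_minus_harmonic_tendsto_0:
  fixes p :: "nat \<Rightarrow> real"
  assumes p: "\<And>i. p i \<le> 1" "\<And>i. c / real (i + d) \<le> p i" and c: "0 < c" and d: "0 < d"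
  shows "(\<lambda>n. \<Prod>i\<in>{m..<n}. 1 - p i) \<longlonglongrightarrow> 0"
proof (rule tendsto_sandwich)
  show "\<forall>\<^sub>F n in sequentially. 0 \<le> (\<Prod>i\<in>{m..<n}. 1 - p i)"
    using p by (auto intro!: always_eventually prod_nonneg)
  have "(\<Prod>i\<in>{m..<n}. 1 - p i) \<le> real (m + d) powr c * real (n + d) powr (- c)" if "m \<le> n" for n
    using that
  proof (induction n rule: dec_induct)
    case base
    then show ?case using d by (simp add: powr_minus field_simps)
  next
    case (step n)
    have "1 - p n \<le> 1 + - (c / real (n + d))" using p(2)[of n] by linarith
    also have "\<dots> \<le> exp (- (c / real (n + d)))" by (rule exp_ge_add_one_self)
    also have "\<dots> \<le> exp (- c * (ln (real (Suc n + d)) - ln (real (n + d))))"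
    proof -
      have "ln (real (Suc n + d)) - ln (real (n + d)) \<le> (real (Suc n + d) - real (n + d)) / real (n + d)"
        using d by (intro ln_diff_le) auto
      then have "c * (ln (real (Suc n + d)) - ln (real (n + d))) \<le> c * (1 / real (n + d))"
        using c by (intro mult_left_mono) auto
      then show ?thesis by simp
    qed
    also have "\<dots> = real (n + d) powr c * real (Suc n + d) powr (- c)"
      using d by (simp add: powr_def exp_add[symmetric] algebra_simps)
    finally have "(\<Prod>i\<in>{m..<n}. 1 - p i) * (1 - p n)
        \<le> (real (m + d) powr c * real (n + d) powr (- c)) * (real (n + d) powr c * real (Suc n + d) powr (- c))"
      using step p by (intro mult_mono) (auto intro!: prod_nonneg)
    also have "\<dots> = real (m + d) powr c * real (Suc n + d) powr (- c)"
      using d by (simp add: powr_minus field_simps)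
    finally show ?case using step(1) by (simp add: prod.atLeastLessThan_Suc)
  qed
  then show "\<forall>\<^sub>F n in sequentially. (\<Prod>i\<in>{m..<n}. 1 - p i) \<le> real (m + d) powr c * real (n + d) powr (- c)"
    by (rule eventually_mono[OF eventually_ge_at_top[of m]])
  have "filterlim (\<lambda>n. real (n + d)) at_top sequentially"
    using filterlim_compose[OF filterlim_real_sequentially filterlim_add_const_nat_at_top] .
  then have "(\<lambda>n. real (n + d) powr (- c)) \<longlonglongrightarrow> 0"
    using c by (intro tendsto_neg_powr) auto
  then show "(\<lambda>n. real (m + d) powr c * real (n + d) powr (- c)) \<longlonglongrightarrow> 0"
    by (rule tendsto_mult_right_zero)
qed simp

text \<open>By Dirichlet the radius \<open>1 / Q\<close> covers all of [0, 1], so radius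
  \<open>\<kappa> / Q\<close> still covers measure \<open>\<kappa> / 10\<close>. \<open>A\<close>
  consists of the cells of width \<open>1 / H\<close> that meet this set. Within a cell
  \<open>q \<theta>\<close> moves by at most \<open>Q / H \<le> \<kappa> / Q\<close>, whence the
  doubled radius.\<close>

lemma near_multiples_digit_set:
  fixes Q H :: nat and \<kappa> :: real
  assumes Q: "0 < Q" and \<kappa>: "0 < \<kappa>" "\<kappa> \<le> 1" and H: "real Q ^ 2 / \<kappa> \<le> real H"
  obtains A where "A \<subseteq> {..<H}" "\<kappa> / 10 * real H \<le> real (card A)"
    "\<And>\<theta>. \<theta> \<in> {0..<1} \<Longrightarrow> nat \<lfloor>real H * \<theta>\<rfloor> \<in> A \<Longrightarrow> \<exists>q\<in>{1..Q}. \<exists>p::int. \<bar>real q * \<theta> - of_int p\<bar> < 2 * \<kappa> / real Q"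
proof -
  let ?U = "near_multiples {1..Q} (\<kappa> * (1 / real Q))"
  have Hpos: "0 < H"
  proof -
    have "0 < real Q ^ 2 / \<kappa>" using Q \<kappa> by simp
    then show ?thesis using H by linarith
  qed
  have full: "near_multiples {1..Q} (1 / real Q) = {0..1}"
  proof (intro equalityI subsetI)
    fix x :: real assume x: "x \<in> {0..1}"
    obtain h k where hk: "0 < k" "k \<le> int Q" "\<bar>of_int k * x - of_int h\<bar> < 1 / real Q"
      using Dirichlet_approx[OF Q, of x] by blast
    then have "nat k \<in> {1..Q}" "real (nat k) = of_int k" by auto
    then show "x \<in> near_multiples {1..Q} (1 / real Q)"
      using hk x unfolding near_multiples_def by (metis (mono_tags, lifting) mem_Collect_eq)
  qed (auto simp: near_multiples_def)
  have "\<kappa> / 10 * measure lborel (near_multiples {1..Q} (1 / real Q)) \<le> measure lborel ?U"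
    by (rule measure_near_multiples_shrink) (use Q \<kappa> in auto)
  then have U: "\<kappa> / 10 \<le> measure lborel ?U" unfolding full by simp
  \<comment> \<open>The endpoint 1 is removed because its digit would be \<open>H\<close>, outside
    the range.\<close>
  define A where "A = (\<lambda>\<theta>. nat \<lfloor>real H * \<theta>\<rfloor>) ` (?U - {1})"
  have AH: "A \<subseteq> {..<H}"
  proof
    fix b assume "b \<in> A"
    then obtain \<theta> where \<theta>: "b = nat \<lfloor>real H * \<theta>\<rfloor>" "\<theta> \<in> {0..1}" "\<theta> \<noteq> 1"
      unfolding A_def using near_multiples_subset by blast
    then have "\<theta> < 1" by simp
    then have "real H * \<theta> < real H" using Hpos by simp
    then show "b \<in> {..<H}" using \<theta> Hpos by (simp add: nat_less_iff floor_less_iff)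
  qed
  have finA: "finite A" using AH finite_subset by blast
  let ?C = "\<Union>r\<in>A. {real r / real H..<(real r + 1) / real H}"
  have "emeasure lborel ?U \<le> emeasure lborel (?C \<union> {1})"
  proof (rule emeasure_mono)
    show "?U \<subseteq> ?C \<union> {1}"
    proof
      fix x assume x: "x \<in> ?U"
      show "x \<in> ?C \<union> {1}"
      proof (cases "x = 1")
        case False
        then have "nat \<lfloor>real H * x\<rfloor> \<in> A" using x by (auto simp: A_def)
        moreover have "0 \<le> x" using x by (simp add: near_multiples_def)
        ultimately show ?thesis using mem_cell[OF Hpos, of x] by blast
      qed simp
    qed
  qed (use finA in auto)
  also have "\<dots> \<le> emeasure lborel ?C + emeasure lborel {1::real}"
    by (rule emeasure_subadditive) (use finA in auto)
  also have "\<dots> \<le> ennreal (real (card A) / real H)"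
    using emeasure_cells_le[OF finA Hpos] by simp
  finally have "measure lborel ?U \<le> real (card A) / real H"
    by (simp add: measure_def enn2real_leI)
  then have "\<kappa> / 10 \<le> real (card A) / real H" using U by linarith
  then have card: "\<kappa> / 10 * real H \<le> real (card A)" using Hpos by (simp add: field_simps)
  have "\<exists>q\<in>{1..Q}. \<exists>p::int. \<bar>real q * \<theta> - of_int p\<bar> < 2 * \<kappa> / real Q"
    if \<theta>: "\<theta> \<in> {0..<1}" "nat \<lfloor>real H * \<theta>\<rfloor> \<in> A" for \<theta>
  proof -
    obtain \<phi> where \<phi>: "\<phi> \<in> ?U" "nat \<lfloor>real H * \<theta>\<rfloor> = nat \<lfloor>real H * \<phi>\<rfloor>"
      using \<theta>(2) by (auto simp: A_def)
    then obtain q p where q: "q \<in> {1..Q}" and p: "\<bar>real q * \<phi> - of_int (p::int)\<bar> < \<kappa> * (1 / real Q)"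
      and \<phi>0: "0 \<le> \<phi>" by (auto simp: near_multiples_def)
    have "\<theta> \<in> {real (nat \<lfloor>real H * \<phi>\<rfloor>) / real H..<(real (nat \<lfloor>real H * \<phi>\<rfloor>) + 1) / real H}"
      using mem_cell[OF Hpos, of \<theta>] \<theta> \<phi>(2) by simp
    moreover have "\<phi> \<in> {real (nat \<lfloor>real H * \<phi>\<rfloor>) / real H..<(real (nat \<lfloor>real H * \<phi>\<rfloor>) + 1) / real H}"
      by (rule mem_cell[OF Hpos \<phi>0])
    ultimately have "\<bar>\<theta> - \<phi>\<bar> \<le> 1 / real H" by (simp add: add_divide_distrib abs_le_iff)
    then have "real q * \<bar>\<theta> - \<phi>\<bar> \<le> real Q * (1 / real H)" using q by (intro mult_mono) auto
    also have "\<dots> \<le> \<kappa> / real Q"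
    proof -
      have "real Q ^ 2 \<le> real H * \<kappa>" using H \<kappa> by (simp add: pos_divide_le_eq)
      then show ?thesis using Hpos Q by (simp add: field_simps power2_eq_square)
    qed
    finally have "\<bar>real q * \<theta> - real q * \<phi>\<bar> \<le> \<kappa> / real Q"
      by (simp add: right_diff_distrib[symmetric] abs_mult)
    then have "\<bar>real q * \<theta> - of_int p\<bar> < 2 * \<kappa> / real Q" using p by simp
    then show ?thesis using q by blast
  qed
  then show thesis using that[OF AH card] by blast
qed

section \<open>The block sequence\<close>

text \<open>
  The fifth root makes \<open>1 / stage j ^ 5\<close> the terms of a divergent series although \<open>stage j\<close> tends to
  infinity; the shift by \<open>1024 = 4 ^ 5\<close> ensures \<open>stage j \<ge> 4\<close>, so that a block fills at most half
  of the indices up to its end.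
\<close>

definition stage :: "nat \<Rightarrow> nat" where
  "stage j = nat \<lfloor>root 5 (real j + 1024)\<rfloor>"

definition block_end :: "nat \<Rightarrow> nat" where
  "block_end j = 4 ^ j * stage j ^ 3"

text \<open>One half of the block is room for the starting index of a tuple, the other half for
  shifts \<open>q * l\<close> with \<open>q \<le> 4 ^ j\<close> and
  \<open>l \<le> stage j ^ 2\<close>.\<close>

definition block_len :: "nat \<Rightarrow> nat" where
  "block_len j = 2 * 4 ^ j * stage j ^ 2"

text \<open>This is \<open>Q ^ 2 / \<kappa>\<close> for \<open>Q = 4 ^ j\<close> and
  \<open>\<kappa> = 1 / (2 * stage j ^ 5)\<close>, the least base that
  \<open>near_multiples_digit_set\<close> admits.\<close>

definition digit_base :: "nat \<Rightarrow> nat" where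
  "digit_base j = 2 * stage j ^ 5 * 16 ^ j"

text \<open>The product of the earlier digit bases, so that the fractional part of
  \<open>block_step j * x\<close> begins with the digit of \<open>x\<close> at position
  \<open>j\<close>.\<close>

primrec block_step :: "nat \<Rightarrow> nat" where
  "block_step 0 = 1"
| "block_step (Suc j) = digit_base j * block_step j"

text \<open>The inequality is strict so that the step leaving the last index of a block is no longer
  assigned to that block.\<close>

definition block_index :: "nat \<Rightarrow> nat" where
  "block_index n = (LEAST j. n < block_end j)"

text \<open>
  \<open>in_block n\<close> refers to the step from \<open>n\<close> to \<open>n + 1\<close>: it holds iff both indices lie in
  \<open>{block_end j - block_len j + 1..block_end j}\<close> for the same \<open>j\<close>.
\<close>

definition in_block :: "nat \<Rightarrow> bool" where
  "in_block n \<longleftrightarrow> block_end (block_index n) - block_len (block_index n) < n"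

text \<open>A single step outside the blocks more than doubles the value, even from 0 because of the
  summand 1.\<close>

primrec block_seq :: "nat \<Rightarrow> nat" where
  "block_seq 0 = 0"
| "block_seq (Suc n) =
    (if in_block n then block_seq n + block_step (block_index n) else 3 * block_seq n + 1)"

declare block_seq.simps(2) [simp del]

section \<open>Growth and separation of the blocks\<close>

lemma stage_eq: "real (stage j) = of_int \<lfloor>root 5 (real j + 1024)\<rfloor>"
  by (simp add: stage_def)

lemma four_le_stage: "4 \<le> stage j"
proof -
  have "root 5 (4 ^ 5) \<le> root 5 (real j + 1024)" by (subst real_root_le_iff) auto
  then have "4 \<le> root 5 (real j + 1024)" by (subst (asm) real_root_power_cancel) auto
  then have "4 \<le> \<lfloor>root 5 (real j + 1024)\<rfloor>" by (simp add: le_floor_iff)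
  then show ?thesis by (simp add: stage_def le_nat_iff)
qed

lemma stage_pos: "0 < stage j"
  using four_le_stage[of j] by simp

lemma stage_power_le: "stage j ^ 5 \<le> j + 1024"
proof -
  have "real (stage j) \<le> root 5 (real j + 1024)" unfolding stage_eq by simp
  then have "real (stage j) ^ 5 \<le> root 5 (real j + 1024) ^ 5" by (intro power_mono) auto
  also have "\<dots> = real (j + 1024)" by (simp add: real_root_pow_pos2)
  finally show ?thesis by (metis of_nat_le_iff of_nat_power)
qed

lemma stage_mono: "i \<le> j \<Longrightarrow> stage i \<le> stage j"
  unfolding stage_def by (intro nat_mono floor_mono) simp

lemma stage_at_top: "filterlim stage at_top sequentially"
  unfolding filterlim_at_top eventually_sequentially
proof
  fix K :: nat
  show "\<exists>j0. \<forall>j\<ge>j0. K \<le> stage j"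
  proof (intro exI[of _ "K ^ 5"] allI impI)
    fix j assume "K ^ 5 \<le> j"
    then have "real K ^ 5 \<le> real j + 1024" by (metis of_nat_le_iff of_nat_power add_increasing2 zero_le_numeral)
    then have "root 5 (real K ^ 5) \<le> root 5 (real j + 1024)" by (subst real_root_le_iff) auto
    then have "real K \<le> root 5 (real j + 1024)" by (subst (asm) real_root_power_cancel) auto
    then have "int K \<le> \<lfloor>root 5 (real j + 1024)\<rfloor>" by (simp add: le_floor_iff)
    then show "K \<le> stage j" by (simp add: stage_def le_nat_iff)
  qed
qed

lemma block_len_le: "2 * block_len j \<le> block_end j"
proof -
  have "4 * (4 ^ j * stage j ^ 2) \<le> stage j * (4 ^ j * stage j ^ 2)"
    by (rule mult_right_mono) (use four_le_stage in auto)
  then show ?thesis by (simp add: block_len_def block_end_def power2_eq_square power3_eq_cube mult_ac)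
qed

lemma stage_mult_block_len: "stage j * block_len j = 2 * block_end j"
  by (simp add: block_len_def block_end_def power2_eq_square power3_eq_cube mult_ac)

lemma block_end_Suc: "4 * block_end j \<le> block_end (Suc j)"
proof -
  have "stage j ^ 3 \<le> stage (Suc j) ^ 3" by (intro power_mono stage_mono) auto
  then show ?thesis by (simp add: block_end_def)
qed

lemma block_end_pos: "0 < block_end j"
  using four_le_stage[of j] by (simp add: block_end_def)

lemma block_end_mono:
  assumes "i \<le> j"
  shows "block_end i \<le> block_end j"
proof (rule lift_Suc_mono_le[OF _ assms])
  show "block_end n \<le> block_end (Suc n)" for n using block_end_Suc[of n] by simp
qed

lemma block_end_less_start: "i < j \<Longrightarrow> block_end i \<le> block_end j - block_len j"
proof -
  assume "i < j"
  then obtain l where l: "j = Suc l" "i \<le> l" by (cases j) auto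
  have "block_end i \<le> block_end l" using l by (intro block_end_mono)
  then show ?thesis using block_end_Suc[of l] block_len_le[of "Suc l"] l by simp
qed

lemma le_block_end: "j \<le> block_end j"
proof (induction j)
  case (Suc j)
  then show ?case using block_end_Suc[of j] block_end_pos[of j] by linarith
qed simp

lemma less_block_end_index: "n < block_end (block_index n)"
  unfolding block_index_def
proof (rule LeastI)
  have "n < Suc n" by simp
  also have "\<dots> \<le> block_end (Suc n)" by (rule le_block_end)
  finally show "n < block_end (Suc n)" .
qed

lemma block_index_eq:
  assumes "block_end j - block_len j < n" "n < block_end j"
  shows "block_index n = j"
  unfolding block_index_def
proof (rule Least_equality)
  fix i assume "n < block_end i"
  then show "j \<le> i" using block_end_less_start[of i j] assms by (cases "i < j") auto
qed (rule assms)

lemma block_step_pos: "0 < block_step j"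
  by (induction j) (simp_all add: digit_base_def stage_pos)

lemma block_seq_less_Suc: "block_seq n < block_seq (Suc n)"
  using block_step_pos by (auto simp: block_seq.simps(2))

lemma strict_mono_block_seq: "strict_mono block_seq"
  by (rule strict_monoI_Suc) (rule block_seq_less_Suc)

lemma block_seq_in_block:
  assumes "i < block_len j"
  shows "block_seq (block_end j - block_len j + 1 + i) = block_seq (block_end j - block_len j + 1) + i * block_step j"
  using assms
proof (induction i)
  case (Suc i)
  let ?n = "block_end j - block_len j + 1 + i"
  have "block_index ?n = j" using Suc.prems block_len_le[of j] by (intro block_index_eq) linarith+
  then have "block_seq (Suc ?n) = block_seq ?n + block_step j"
    by (simp add: in_block_def block_seq.simps(2))
  then show ?case using Suc by simp
qed simp

text \<open>A run of \<open>W\<close> or more steps cannot stay inside one block, since every block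
  starting before \<open>N\<close> has length at most \<open>W\<close>. So it contains a step
  outside the blocks, which more than doubles the sequence.\<close>

lemma block_seq_sparse:
  assumes W: "\<And>j. block_end j - block_len j < N \<Longrightarrow> block_len j \<le> W"
    and n: "1 \<le> n" "n + W \<le> m" "m \<le> N" and W0: "0 < W"
  shows "2 * block_seq n < block_seq m"
proof (cases "\<exists>i\<in>{n..<m}. \<not> in_block i")
  case True
  then obtain i where i: "n \<le> i" "i < m" "\<not> in_block i" by auto
  have "block_seq (Suc i) = 3 * block_seq i + 1" using i by (simp add: block_seq.simps(2))
  moreover have "block_seq n \<le> block_seq i" "block_seq (Suc i) \<le> block_seq m"
    using i strict_mono_less_eq[OF strict_mono_block_seq] by auto
  ultimately show ?thesis by linarith
next
  case False
  let ?J = "block_index n"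
  have nb: "in_block n" using False n W0 by auto
  then have start: "block_end ?J - block_len ?J < n" by (simp add: in_block_def)
  \<comment> \<open>Otherwise the step at \<open>block_end ?J\<close> would lie in a later block,
    but later blocks start at or after that index.\<close>
  have "m \<le> block_end ?J"
  proof (rule ccontr)
    assume "\<not> m \<le> block_end ?J"
    then have "in_block (block_end ?J)" using False less_block_end_index[of n] by auto
    then have s: "block_end (block_index (block_end ?J)) - block_len (block_index (block_end ?J)) < block_end ?J"
      by (simp add: in_block_def)
    have "\<not> block_index (block_end ?J) \<le> ?J"
      using block_end_mono less_block_end_index[of "block_end ?J"] by (meson not_le)
    then show False using block_end_less_start[of ?J "block_index (block_end ?J)"] s by simp
  qed
  then have "m - n < block_len ?J" using start block_len_le[of ?J] n W0 by linarith
  moreover have "block_len ?J \<le> W" using start n by (intro W) linarith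
  ultimately show ?thesis using n by linarith
qed

text \<open>A block starting before \<open>N\<close> ends before \<open>2 * N\<close>, so its length
  is below \<open>4 * N / stage j\<close>; this handles large \<open>j\<close>. The finitely many
  remaining blocks have bounded length.\<close>

lemma block_len_eventually_small:
  assumes \<epsilon>: "0 < \<epsilon>"
  shows "\<exists>N0. \<forall>N\<ge>N0. \<forall>j. block_end j - block_len j < N \<longrightarrow> real (block_len j) \<le> \<epsilon> * real N"
proof -
  obtain j0 where j0: "\<And>j. j0 \<le> j \<Longrightarrow> nat \<lceil>4 / \<epsilon>\<rceil> \<le> stage j"
    using stage_at_top unfolding filterlim_at_top eventually_sequentially by metis
  show ?thesis
  proof (intro exI[of _ "nat \<lceil>real (block_end j0) / \<epsilon>\<rceil>"] allI impI)
    fix N j assume N: "nat \<lceil>real (block_end j0) / \<epsilon>\<rceil> \<le> N" and j: "block_end j - block_len j < N"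
    show "real (block_len j) \<le> \<epsilon> * real N"
    proof (cases "j0 \<le> j")
      case True
      have "4 / \<epsilon> \<le> real (stage j)" using j0[OF True] by (simp add: nat_ceiling_le_eq)
      then have "4 \<le> \<epsilon> * real (stage j)" using \<epsilon> by (simp add: field_simps)
      then have "4 * real (block_len j) \<le> \<epsilon> * real (stage j) * real (block_len j)" by (intro mult_right_mono) auto
      also have "\<dots> = \<epsilon> * real (2 * block_end j)" using stage_mult_block_len[of j]
        by (metis mult.assoc of_nat_mult)
      also have "\<dots> \<le> \<epsilon> * (4 * real N)"
        using j block_len_le[of j] \<epsilon> by (intro mult_left_mono) auto
      finally show ?thesis by simp
    next
      case False
      then have "block_len j \<le> block_end j0" using block_len_le[of j] block_end_mono[of j j0] by simp
      moreover have "real (block_end j0) / \<epsilon> \<le> real N" using N by (simp add: nat_ceiling_le_eq)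
      ultimately show ?thesis using \<epsilon> by (simp add: field_simps)
    qed
  qed
qed

lemma block_seq_energy: "(\<lambda>N. real (additive_energy (block_seq ` {1..N}))) \<in> o(\<lambda>N. real N ^ 3)"
proof (rule landau_o.smallI)
  fix c :: real assume c: "0 < c"
  \<comment> \<open>The energy bound is \<open>8 * W * N ^ 2\<close>, and rounding up gives
    \<open>W \<le> 2 * \<epsilon> * N\<close>; together they produce the factor 16.\<close>
  define \<epsilon> where "\<epsilon> = c / 16"
  have \<epsilon>: "0 < \<epsilon>" using c by (simp add: \<epsilon>_def)
  obtain N0 where N0: "\<And>N j. N0 \<le> N \<Longrightarrow> block_end j - block_len j < N \<Longrightarrow> real (block_len j) \<le> \<epsilon> * real N"
    using block_len_eventually_small[OF \<epsilon>] by blast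
  show "\<forall>\<^sub>F N in sequentially. norm (real (additive_energy (block_seq ` {1..N}))) \<le> c * norm (real N ^ 3)"
    using eventually_ge_at_top[of "max N0 (nat \<lceil>1 / \<epsilon>\<rceil>)"]
  proof eventually_elim
    case (elim N)
    define W where "W = nat \<lceil>\<epsilon> * real N\<rceil>"
    have "1 / \<epsilon> \<le> real N" using elim by (simp add: nat_ceiling_le_eq)
    then have N1: "1 \<le> \<epsilon> * real N" using \<epsilon> by (simp add: field_simps)
    have "real W = of_int \<lceil>\<epsilon> * real N\<rceil>" using N1 by (simp add: W_def)
    then have W: "\<epsilon> * real N \<le> real W" "real W \<le> 2 * (\<epsilon> * real N)" using N1 by linarith+
    have "additive_energy (block_seq ` {1..N}) \<le> 8 * W * N ^ 2"
    proof (rule additive_energy_le_of_sparse)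
      fix m n assume mn: "1 \<le> n" "n + W \<le> m" "m \<le> N"
      have "block_len j \<le> W" if "block_end j - block_len j < N" for j
        using N0[of N j] that elim W by linarith
      moreover have "0 < W" using W N1 by (cases "W = 0") auto
      ultimately show "2 * block_seq n < block_seq m" using mn block_seq_sparse by blast
    qed
    then have "real (additive_energy (block_seq ` {1..N})) \<le> 8 * real W * real N ^ 2"
      by (metis (mono_tags, opaque_lifting) of_nat_le_iff of_nat_mult of_nat_numeral of_nat_power)
    also have "\<dots> \<le> 8 * (2 * (\<epsilon> * real N)) * real N ^ 2" using W by (intro mult_right_mono mult_left_mono) auto
    also have "\<dots> = c * real N ^ 3" by (simp add: \<epsilon>_def power2_eq_square power3_eq_cube)
    finally show ?case by simp
  qed
qed

text \<open>With \<open>t = stage j\<close> and \<open>Q = 4 ^ j\<close>, shifting an index by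
  \<open>q * l\<close> for \<open>l \<le> t^2\<close> moves the point by at most
  \<open>t^2 / (t^5 Q) = 1 / block_end j\<close> modulo 1. There are \<open>Q t^2\<close> starting
  indices and \<open>t^2 + 2 - k\<close> choices of \<open>l\<close>, while
  \<open>block_end j = Q t^3\<close>.\<close>

lemma block_seq_correlation_ge:
  assumes q: "q \<in> {1..4 ^ j}" and close: "\<bar>real q * (real (block_step j) * x) - of_int (p::int)\<bar> < 1 / (real (stage j) ^ 5 * 4 ^ j)"
    and k: "2 \<le> k" "k \<le> stage j"
  shows "real (stage j) - real k \<le> correlation k (tent_prod (\<lambda>_. 1) k) (\<lambda>n. frac (real (block_seq n) * x)) (block_end j)"
proof -
  define t Q where "t = stage j" and "Q = (4::nat) ^ j"
  define L where "L = t ^ 2"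
  let ?N = "block_end j"
  define h where "h = block_end j - block_len j + 1"
  have t: "4 \<le> t" using four_le_stage by (simp add: t_def)
  have Qpos: "0 < Q" by (simp add: Q_def)
  have N: "?N = Q * t ^ 3" and M: "block_len j = 2 * Q * L"
    by (simp_all add: block_end_def block_len_def t_def Q_def L_def)
  have kL: "k \<le> L" using k t by (simp add: L_def t_def power2_eq_square) (metis le_square le_trans)
  \<comment> \<open>Only the second entry of a tuple varies with \<open>l\<close>; the later entries
    use the fixed multiples 1, ..., k - 2. The condition \<open>l \<ge> k - 1\<close> keeps all
    entries distinct.\<close>
  define off where "off l i = (if i = (1::nat) then 0 else if i = 2 then l else i - 2)" for l i :: nat
  define tr where "tr = (\<lambda>(m, l). \<lambda>i\<in>{1..k}. h + (m + q * off l i))"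
  define X where "X = {..<Q * L} \<times> {k - 1..L}"
  have offL: "off l i \<le> L" if "l \<in> {k - 1..L}" "i \<in> {1..k}" for l i
    using that kL by (auto simp: off_def)
  have idx: "m + q * off l i < block_len j" if "m < Q * L" "l \<in> {k - 1..L}" "i \<in> {1..k}" for m l i
  proof -
    have "q * off l i \<le> Q * L" using q offL[OF that(2,3)] by (intro mult_mono) (auto simp: Q_def)
    then show ?thesis using that M by simp
  qed
  have off_inj: "inj_on (off l) {1..k}" if "l \<in> {k - 1..L}" for l
    using that k by (auto simp: inj_on_def off_def split: if_splits)
  have seq: "block_seq (h + i) = block_seq h + i * block_step j" if "i < block_len j" for i
    using block_seq_in_block[OF that] by (simp add: h_def)
  have sd: "real ?N * \<bar>signed_dist (frac (real (block_seq (h + m)) * x) - frac (real (block_seq (h + (m + q * l))) * x))\<bar> \<le> 1"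
    if "m + q * l < block_len j" "l \<le> L" for m l
  proof -
    have "\<bar>signed_dist (frac (real (block_seq (h + m)) * x) - frac (real (block_seq (h + (m + q * l))) * x))\<bar>
        \<le> \<bar>real (block_seq (h + m)) * x - real (block_seq (h + (m + q * l))) * x - of_int (- (int l * p))\<bar>"
      by (rule abs_signed_dist_frac_diff_le)
    also have "real (block_seq (h + m)) * x - real (block_seq (h + (m + q * l))) * x - of_int (- (int l * p))
        = - (real l * (real q * (real (block_step j) * x) - of_int p))"
      using seq[of m] seq[OF that(1)] that by (simp add: algebra_simps)
    also have "\<bar>\<dots>\<bar> = real l * \<bar>real q * (real (block_step j) * x) - of_int p\<bar>" by (simp add: abs_mult)
    also have "\<dots> \<le> real L * (1 / (real t ^ 5 * real Q))"
      using close that by (intro mult_mono) (auto simp: t_def Q_def)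
    also have "\<dots> = 1 / real ?N"
      using t Qpos by (simp add: N L_def field_simps power_add[symmetric])
    finally show ?thesis using block_end_pos[of j] by (simp add: field_simps)
  qed
  have "real (card (tr ` X)) / real ?N \<le> correlation k (tent_prod (\<lambda>_. 1) k) (\<lambda>n. frac (real (block_seq n) * x)) ?N"
  proof (rule correlation_tent_prod_ge)
    show "tr ` X \<subseteq> {i \<in> {1..k} \<rightarrow>\<^sub>E {1..?N}. inj_on i {1..k}}"
    proof
      fix z assume "z \<in> tr ` X"
      then obtain m l where z: "z = tr (m, l)" and ml: "m < Q * L" "l \<in> {k - 1..L}"
        unfolding X_def by blast
      have "z \<in> {1..k} \<rightarrow>\<^sub>E {1..?N}"
        using idx[OF ml] block_len_le[of j] by (fastforce simp: z tr_def h_def)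
      moreover have "inj_on z {1..k}"
      proof (rule inj_onI)
        fix i i' assume i: "i \<in> {1..k}" "i' \<in> {1..k}" "z i = z i'"
        then have "q * off l i = q * off l i'" by (simp add: z tr_def)
        then have "off l i = off l i'" using q by simp
        then show "i = i'" using off_inj[OF ml(2)] i by (meson inj_onD)
      qed
      ultimately show "z \<in> {i \<in> {1..k} \<rightarrow>\<^sub>E {1..?N}. inj_on i {1..k}}" by blast
    qed
    show "real ?N * \<bar>signed_dist (frac (real (block_seq (i 1)) * x) - frac (real (block_seq (i r)) * x))\<bar> \<le> 1"
      if i: "i \<in> tr ` X" and r: "r \<in> {2..k}" for i r
    proof -
      obtain m l where z: "i = tr (m, l)" and ml: "m < Q * L" "l \<in> {k - 1..L}"
        using i unfolding X_def by blast
      have "i 1 = h + m" "i r = h + (m + q * off l r)" using r k by (auto simp: z tr_def off_def)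
      moreover have "m + q * off l r < block_len j" "off l r \<le> L"
        using idx[OF ml, of r] offL[OF ml(2), of r] r by auto
      ultimately show ?thesis using sd by simp
    qed
  qed simp
  moreover have "card (tr ` X) = card X"
  proof (rule card_image, rule inj_onI)
    fix u v assume "u \<in> X" "v \<in> X" and eq: "tr u = tr v"
    obtain m l m' l' where uv: "u = (m, l)" "v = (m', l')" by (cases u, cases v)
    have "tr u 1 = tr v 1" "tr u 2 = tr v 2" using eq by simp_all
    then have "m = m'" "m + q * l = m' + q * l'" using k by (simp_all add: uv tr_def off_def)
    then show "u = v" using q by (simp add: uv)
  qed
  moreover have "card X = Q * L * (L + 2 - k)" using k kL by (simp add: X_def card_cartesian_product)
  moreover have "real t - real k \<le> real (Q * L * (L + 2 - k)) / real ?N"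
  proof -
    have "(real t - real k) * real t \<le> real L - real k"
    proof -
      have "real k * 1 \<le> real k * real t" using t by (intro mult_left_mono) auto
      then show ?thesis by (simp add: L_def power2_eq_square algebra_simps)
    qed
    also have "\<dots> \<le> real (L + 2 - k)" using kL by simp
    finally have "(real t - real k) * real t * (real Q * real L) \<le> real (L + 2 - k) * (real Q * real L)"
      by (intro mult_right_mono) auto
    then have "(real t - real k) * real ?N \<le> real (Q * L * (L + 2 - k))"
      by (simp add: N L_def power2_eq_square power3_eq_cube mult_ac)
    then show ?thesis using block_end_pos[of j] by (simp add: pos_le_divide_eq)
  qed
  ultimately show ?thesis by (simp add: t_def)
qed

text \<open>Poissonian correlations converge and are therefore bounded, whereas along the given
  block ends they are at least \<open>stage j - k\<close>, which is unbounded.\<close>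

lemma not_poissonian_block_seq:
  assumes inf: "infinite {j. \<exists>q\<in>{1..4 ^ j}. \<exists>p::int.
      \<bar>real q * (real (block_step j) * x) - of_int p\<bar> < 1 / (real (stage j) ^ 5 * 4 ^ j)}"
    and k: "2 \<le> k"
  shows "\<not> poissonian_correlations k (\<lambda>n. frac (real (block_seq n) * x))"
proof
  assume P: "poissonian_correlations k (\<lambda>n. frac (real (block_seq n) * x))"
  let ?f = "tent_prod (\<lambda>_. 1) k"
  let ?c = "correlation k ?f (\<lambda>n. frac (real (block_seq n) * x))"
  have "nonneg_Cc k ?f" by (rule nonneg_Cc_tent_prod) simp
  then have "convergent ?c" using P unfolding poissonian_correlations_def convergent_def by blast
  then have "Bseq ?c" by (rule convergent_imp_Bseq)
  then obtain B where B: "\<And>N. norm (?c N) \<le> B" using BseqE by blast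
  obtain j0 where j0: "\<And>j. j0 \<le> j \<Longrightarrow> k + nat \<lceil>B\<rceil> + 1 \<le> stage j"
    using stage_at_top unfolding filterlim_at_top eventually_sequentially by metis
  obtain j q p where j: "j0 \<le> j" and q: "q \<in> {1..4 ^ j}"
    and p: "\<bar>real q * (real (block_step j) * x) - of_int (p::int)\<bar> < 1 / (real (stage j) ^ 5 * 4 ^ j)"
    using inf unfolding infinite_nat_iff_unbounded_le by blast
  have "real (stage j) - real k \<le> ?c (block_end j)"
    by (rule block_seq_correlation_ge[OF q p k]) (use j0[OF j] in simp)
  also have "\<dots> \<le> B" using B[of "block_end j"] by simp
  finally have "real (stage j) \<le> real k + B" by simp
  moreover have "real (k + nat \<lceil>B\<rceil> + 1) \<le> real (stage j)" using j0[OF j] by (rule of_nat_mono)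
  moreover have "B \<le> real (nat \<lceil>B\<rceil>)" by (rule real_nat_ceiling_ge)
  ultimately show False by simp
qed

text \<open>The condition at stage \<open>j\<close> follows from a digit condition of density at
  least \<open>1 / (20 * stage j ^ 5)\<close>, and \<open>stage j ^ 5 \<le> j + 1024\<close> makes
  these densities dominate a harmonic series.\<close>

lemma AE_block_seq:
  "AE x in lborel. x \<in> {0..<1} \<longrightarrow> infinite {j. \<exists>q\<in>{1..4 ^ j}. \<exists>p::int.
      \<bar>real q * (real (block_step j) * x) - of_int p\<bar> < 1 / (real (stage j) ^ 5 * 4 ^ j)}"
proof -
  let ?\<kappa> = "\<lambda>j. 1 / (2 * real (stage j) ^ 5)"
  let ?close = "\<lambda>j y. \<exists>q\<in>{1..4 ^ j}. \<exists>p::int. \<bar>real q * y - of_int p\<bar> < 1 / (real (stage j) ^ 5 * 4 ^ j)"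
  have t: "1 \<le> real (stage j)" for j using four_le_stage[of j] by simp
  let ?P = "\<lambda>j A. A \<subseteq> {..<digit_base j} \<and> ?\<kappa> j / 10 * real (digit_base j) \<le> real (card A) \<and>
      (\<forall>\<theta>\<in>{0..<1}. nat \<lfloor>real (digit_base j) * \<theta>\<rfloor> \<in> A \<longrightarrow> ?close j \<theta>)"
  have "\<exists>A. ?P j A" for j
  proof -
    have \<kappa>: "0 < ?\<kappa> j" "?\<kappa> j \<le> 1"
    proof -
      have "1 \<le> real (stage j) ^ 5" by (rule one_le_power[OF t])
      then have "1 \<le> 2 * real (stage j) ^ 5" by linarith
      then show "?\<kappa> j \<le> 1" by (subst divide_le_eq_1_pos) linarith+
      show "0 < ?\<kappa> j" using stage_pos[of j] by simp
    qed
    have H: "real (4 ^ j) ^ 2 / ?\<kappa> j \<le> real (digit_base j)"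
      by (simp add: digit_base_def power2_eq_square power_mult_distrib[symmetric] mult_ac)
    obtain A where A: "A \<subseteq> {..<digit_base j}" "?\<kappa> j / 10 * real (digit_base j) \<le> real (card A)"
      "\<And>\<theta>. \<theta> \<in> {0..<1} \<Longrightarrow> nat \<lfloor>real (digit_base j) * \<theta>\<rfloor> \<in> A \<Longrightarrow>
        \<exists>q\<in>{1..4 ^ j}. \<exists>p::int. \<bar>real q * \<theta> - of_int p\<bar> < 2 * ?\<kappa> j / real (4 ^ j)"
      using near_multiples_digit_set[OF _ \<kappa> H] by auto
    have "2 * ?\<kappa> j / real (4 ^ j) = 1 / (real (stage j) ^ 5 * 4 ^ j)" by simp
    then show ?thesis using A by (intro exI[of _ A]) auto
  qed
  then have "\<exists>A. \<forall>j. ?P j (A j)" by (intro choice allI)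
  then obtain A where P0: "\<forall>j. ?P j (A j)" by (rule exE)
  note P = P0[THEN spec]
  note A = P[THEN conjunct1] P[THEN conjunct2, THEN conjunct1]
    P[THEN conjunct2, THEN conjunct2, THEN bspec, THEN mp]
  have Hpos: "0 < digit_base j" for j using four_le_stage[of j] by (simp add: digit_base_def)
  have "AE x in lborel. x \<in> {0..<1} \<longrightarrow>
      infinite {j. nat \<lfloor>real (digit_base j) * frac (real (block_step j) * x)\<rfloor> \<in> A j}"
  proof (rule AE_digit_infinitely_often[OF _ _ Hpos A(1)])
    fix m
    show "(\<lambda>n. \<Prod>i\<in>{m..<n}. 1 - real (card (A i)) / real (digit_base i)) \<longlonglongrightarrow> 0"
    proof (rule prod_one_minus_harmonic_tendsto_0[where c = "1 / 20" and d = 1024])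
      fix i
      show "real (card (A i)) / real (digit_base i) \<le> 1"
        using card_mono[OF _ A(1)[of i]] Hpos[of i] by (simp add: divide_le_eq)
      have "real (stage i) ^ 5 \<le> real (i + 1024)" using stage_power_le by (metis of_nat_le_iff of_nat_power)
      then have "1 / 20 / real (i + 1024) \<le> 1 / 20 / real (stage i) ^ 5"
        using t[of i] by (intro divide_left_mono) auto
      also have "\<dots> = ?\<kappa> i / 10" by simp
      also have "\<dots> \<le> real (card (A i)) / real (digit_base i)"
        using A(2)[of i] Hpos[of i] by (simp add: pos_le_divide_eq)
      finally show "1 / 20 / real (i + 1024) \<le> real (card (A i)) / real (digit_base i)" .
    qed auto
  qed auto
  then show ?thesis
  proof eventually_elim
    case (elim x)
    show ?case
    proof
      assume "x \<in> {0..<1}"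
      then have "infinite {j. nat \<lfloor>real (digit_base j) * frac (real (block_step j) * x)\<rfloor> \<in> A j}" using elim by blast
      moreover have "{j. nat \<lfloor>real (digit_base j) * frac (real (block_step j) * x)\<rfloor> \<in> A j}
          \<subseteq> {j. ?close j (real (block_step j) * x)}"
      proof clarify
        fix j assume j: "nat \<lfloor>real (digit_base j) * frac (real (block_step j) * x)\<rfloor> \<in> A j"
        let ?y = "real (block_step j) * x"
        have "frac ?y \<in> {0..<1}" by (simp add: frac_lt_1)
        from A(3)[OF this j] obtain q p where q: "q \<in> {1..4 ^ j}"
          and p: "\<bar>real q * frac ?y - of_int (p::int)\<bar> < 1 / (real (stage j) ^ 5 * 4 ^ j)" by blast
        \<comment> \<open>The integer part of \<open>?y\<close> is absorbed into \<open>p\<close>,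
          which passes from the fractional part back to \<open>?y\<close>.\<close>
        have "real q * ?y - of_int (p + int q * \<lfloor>?y\<rfloor>) = real q * frac ?y - of_int p"
          by (simp add: frac_def algebra_simps)
        then show "?close j ?y" using q p by metis
      qed
      ultimately show "infinite {j. ?close j (real (block_step j) * x)}" using finite_subset by blast
    qed
  qed
qed

lemma AE_not_poissonian_block_seq:
  "AE x in lebesgue_on {0..1}. \<forall>k\<ge>2. \<not> poissonian_correlations k (\<lambda>n. frac (real (block_seq n) * x))"
proof -
  \<comment> \<open>The digit argument covers [0, 1); the remaining endpoint 1 is a null
    set.\<close>
  have "AE x in lborel. x \<noteq> (1::real)" by (rule AE_lborel_singleton)
  with AE_block_seq have "AE x in lborel. x \<in> {0..1} \<longrightarrow>
      (\<forall>k\<ge>2. \<not> poissonian_correlations k (\<lambda>n. frac (real (block_seq n) * x)))"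
  proof eventually_elim
    case (elim x)
    then show ?case using not_poissonian_block_seq by auto
  qed
  then have "AE x in lebesgue. x \<in> {0..1} \<longrightarrow>
      (\<forall>k\<ge>2. \<not> poissonian_correlations k (\<lambda>n. frac (real (block_seq n) * x)))"
    by (rule AE_completion)
  then show ?thesis by (subst AE_restrict_space_iff) auto
qed

theorem theorem4:
  "(\<exists>a :: nat \<Rightarrow> nat.
      strict_mono_on {1..} a \<and> (\<forall>n\<ge>1. 0 < a n) \<and>
      (\<lambda>N. real (additive_energy (a ` {1..N}))) \<in> o(\<lambda>N. real N ^ 3) \<and>
      (AE x in lebesgue_on {0..1}.
         \<forall>k\<ge>2. \<not> poissonian_correlations k (\<lambda>n. frac (real (a n) * x)))) \<and>
   (\<forall>a :: nat \<Rightarrow> nat.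
      strict_mono_on {1..} a \<longrightarrow> (\<forall>n\<ge>1. 0 < a n) \<longrightarrow>
      limsup (\<lambda>N. ereal (real (additive_energy (a ` {1..N})) / real N ^ 3)) > 0 \<longrightarrow>
      (\<exists>X \<in> sets lebesgue. X \<subseteq> {0..1} \<and> emeasure lebesgue X > 0 \<and>
         (\<forall>x\<in>X. \<not> poissonian_correlations 3 (\<lambda>n. frac (real (a n) * x)))))"
proof (intro conjI allI impI)
  have "strict_mono_on {1..} block_seq"
    using strict_mono_block_seq by (auto simp: strict_mono_on_def strict_mono_less)
  moreover have "0 < block_seq n" if "1 \<le> n" for n
    using that block_seq_less_Suc[of "n - 1"] by simp
  ultimately show "\<exists>a :: nat \<Rightarrow> nat.
      strict_mono_on {1..} a \<and> (\<forall>n\<ge>1. 0 < a n) \<and>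
      (\<lambda>N. real (additive_energy (a ` {1..N}))) \<in> o(\<lambda>N. real N ^ 3) \<and>
      (AE x in lebesgue_on {0..1}.
         \<forall>k\<ge>2. \<not> poissonian_correlations k (\<lambda>n. frac (real (a n) * x)))"
    using block_seq_energy AE_not_poissonian_block_seq by (intro exI[of _ block_seq] conjI allI impI) auto
next
  fix a :: "nat \<Rightarrow> nat"
  assume "strict_mono_on {1..} a"
    and "limsup (\<lambda>N. ereal (real (additive_energy (a ` {1..N})) / real N ^ 3)) > 0"
  then show "\<exists>X \<in> sets lebesgue. X \<subseteq> {0..1} \<and> emeasure lebesgue X > 0 \<and>
      (\<forall>x\<in>X. \<not> poissonian_correlations 3 (\<lambda>n. frac (real (a n) * x)))"
    by (rule not_poissonian_3_of_large_energy)
qed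

end
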